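(* Let $(T_1,T_2)$ be a pair of commuting contractions on a Hilbert space $\mathcal H$. Then the $7$-tuple of operators $$\mathbf T=(T_1,\ T_2,\ T_1T_2,\ T_1T_2,\ T_1^2T_2,\ T_1T_2^2,\ T_1^2T_2^2)$$ always has a $\Gamma_{E(3;3;1,1,1)}$-isometric dilation.
   Context: All Hilbert spaces are complex. For a linear subspace $E\subset\mathcal M_{n\times n}(\mathbb C)$, $\mu_E(A)=1/\inf\{\|X\|: X\in E,\ \det(1-AX)=0\}$, with $\mu_E(A)=0$ if $1-AX$ is nonsingular for all $X\in E$ ($\|\cdot\|$ is the operator norm). Let $E(3;3;1,1,1)$ be the space of diagonal $3\times3$ complex matrices. Then $\Gamma_{E(3;3;1,1,1)}\subset\mathbb C^7$ is the set of points $(x_1,\dots,x_7)$ with $x_1=a_{11}$, $x_2=a_{22}$, $x_3=a_{11}a_{22}-a_{12}a_{21}$, $x_4=a_{33}$, $x_5=a_{11}a_{33}-a_{13}a_{31}$, $x_6=a_{22}a_{33}-a_{23}a_{32}$, $x_7=\det A$, where $A=(a_{ij})\in\mathcal M_{3\times3}(\mathbb C)$ and $\mu_{E(3;3;1,1,1)}(A)\le1$. Let $$K=\{\mathbf x\in\Gamma_{E(3;3;1,1,1)}: x_1=\bar x_6x_7,\ x_3=\bar x_4x_7,\ x_5=\bar x_2x_7,\ |x_7|=1\}.$$ A $\Gamma_{E(3;3;1,1,1)}$-unitary is a commuting $7$-tuple of normal operators with Taylor joint spectrum contained in $K$. A $\Gamma_{E(3;3;1,1,1)}$-isometry is the restriction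 of a $\Gamma_{E(3;3;1,1,1)}$-unitary to a joint invariant subspace. A $\Gamma_{E(3;3;1,1,1)}$-isometric dilation of a commuting $7$-tuple $(X_1,\dots,X_7)$ on $\mathcal H$ is a $\Gamma_{E(3;3;1,1,1)}$-isometry $(V_1,\dots,V_7)$ on a Hilbert space $\mathcal K\supseteq\mathcal H$ with $V_i^*|_{\mathcal H}=X_i^*$ for $1\le i\le7$. *)

theory Defs
  imports "HOL-Analysis.Analysis"
begin

section \<open>Complex Hilbert spaces\<close>

text \<open>
  A complex inner product space is a real inner product space (in the sense of HOL-Analysis)
  with a compatible complex structure; the real inner product is the real part of the complex
  one, so norm and topology are the usual ones.  The complex inner product is linear in its
  first argument.
\<close>

class complex_inner = real_inner +
  fixes scaleC :: "complex \<Rightarrow> 'a \<Rightarrow> 'a" (infixr \<open>*\<^sub>C\<close> 75)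
    and cinner :: "'a \<Rightarrow> 'a \<Rightarrow> complex"
  assumes scaleC_add_right: "c *\<^sub>C (x + y) = c *\<^sub>C x + c *\<^sub>C y"
    and scaleC_add_left: "(c + d) *\<^sub>C x = c *\<^sub>C x + d *\<^sub>C x"
    and scaleC_scaleC: "c *\<^sub>C (d *\<^sub>C x) = (c * d) *\<^sub>C x"
    and scaleR_scaleC: "r *\<^sub>R x = complex_of_real r *\<^sub>C x"
    and cinner_commute: "cinner x y = cnj (cinner y x)"
    and cinner_add_left: "cinner (x + y) z = cinner x z + cinner y z"
    and cinner_scaleC_left: "cinner (c *\<^sub>C x) y = c * cinner x y"
    and inner_eq_Re_cinner: "inner x y = Re (cinner x y)"

class chilbert_space = complex_inner + complete_space

lemma cinner_self: "cinner x x = complex_of_real ((norm x)\<^sup>2)" for x :: "'a::complex_inner"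
proof -
  have "Im (cinner x x) = 0"
    by (metis cinner_commute complex_cnj_cancel_iff Reals_cnj_iff complex_is_Real_iff)
  then show ?thesis
    by (simp add: complex_eq_iff power2_norm_eq_inner inner_eq_Re_cinner)
qed

lemma cinner_zero_left: "cinner 0 y = 0" for y :: "'a::complex_inner"
  using cinner_add_left[of 0 0 y] by simp

lemma cinner_diff_left: "cinner (x - y) z = cinner x z - cinner y z" for z :: "'a::complex_inner"
  using cinner_add_left[of "x - y" y z] by simp

lemma norm_scaleC: "norm (c *\<^sub>C x) = norm c * norm x" for x :: "'a::complex_inner"
proof -
  have "cinner (c *\<^sub>C x) (c *\<^sub>C x) = c * cnj c * cinner x x"
    by (metis cinner_commute cinner_scaleC_left complex_cnj_mult mult.assoc mult.commute)
  then have "complex_of_real ((norm (c *\<^sub>C x))\<^sup>2) = complex_of_real ((norm c * norm x)\<^sup>2)"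
    by (simp only: cinner_self complex_norm_square[symmetric] of_real_mult[symmetric]
          of_real_power[symmetric] power_mult_distrib)
  then have "(norm (c *\<^sub>C x))\<^sup>2 = (norm c * norm x)\<^sup>2"
    using of_real_eq_iff by blast
  then show ?thesis
    by (simp add: power2_eq_iff_nonneg)
qed

lemma cinner_eq_Complex_inner: "cinner x y = Complex (inner x y) (- inner (\<i> *\<^sub>C x) y)"
  for x y :: "'a::complex_inner"
  by (simp add: complex_eq_iff inner_eq_Re_cinner cinner_scaleC_left)

section \<open>Square-summable sequences\<close>

text \<open>
  HOL cannot quantify existentially over types, so the Hilbert spaces whose existence is asserted
  below are realised as closed subspaces of the space of square-summable sequences over a given
  Hilbert space.
\<close>

definition sqsum :: "(nat \<Rightarrow> 'a::real_inner) \<Rightarrow> bool" where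
  "sqsum x \<longleftrightarrow> summable (\<lambda>n. (norm (x n))\<^sup>2)"

lemma sqsum_zero: "sqsum (\<lambda>_. 0)"
  by (simp add: sqsum_def)

lemma norm_add_sq_le: "(norm (x + y))\<^sup>2 \<le> 2 * (norm x)\<^sup>2 + 2 * (norm y)\<^sup>2"
  for x y :: "'a::real_inner"
proof -
  have "(norm (x + y))\<^sup>2 + (norm (x - y))\<^sup>2 = 2 * (norm x)\<^sup>2 + 2 * (norm y)\<^sup>2"
    by (simp add: power2_norm_eq_inner inner_add_left inner_add_right inner_diff_left
          inner_diff_right inner_commute)
  then show ?thesis
    using zero_le_power2[of "norm (x - y)"] by linarith
qed

lemma sqsum_add: "sqsum x \<Longrightarrow> sqsum y \<Longrightarrow> sqsum (\<lambda>n. x n + y n)"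
  unfolding sqsum_def
  by (rule summable_comparison_test'[where N = 0 and
        g = "\<lambda>n. 2 * (norm (x n))\<^sup>2 + 2 * (norm (y n))\<^sup>2"])
     (auto intro!: summable_add summable_mult simp: norm_add_sq_le)

lemma sqsum_minus: "sqsum x \<Longrightarrow> sqsum (\<lambda>n. - x n)"
  by (simp add: sqsum_def)

lemma sqsum_diff: "sqsum x \<Longrightarrow> sqsum y \<Longrightarrow> sqsum (\<lambda>n. x n - y n)"
  using sqsum_add[of x "\<lambda>n. - y n"] sqsum_minus[of y] by simp

lemma sqsum_scaleR: "sqsum x \<Longrightarrow> sqsum (\<lambda>n. r *\<^sub>R x n)"
  by (simp add: sqsum_def power_mult_distrib summable_mult)

lemma sqsum_scaleC: "sqsum x \<Longrightarrow> sqsum (\<lambda>n. c *\<^sub>C x n)" for x :: "nat \<Rightarrow> 'a::complex_inner"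
  by (simp add: sqsum_def norm_scaleC power_mult_distrib summable_mult)

lemma sqsum_summable_inner:
  assumes "sqsum x" "sqsum y"
  shows "summable (\<lambda>n. inner (x n) (y n))"
proof (rule summable_comparison_test'[where N = 0])
  show "summable (\<lambda>n. (norm (x n))\<^sup>2 + (norm (y n))\<^sup>2)"
    using assms by (auto simp: sqsum_def intro: summable_add)
  fix n
  have "norm (inner (x n) (y n)) \<le> norm (x n) * norm (y n)"
    using Cauchy_Schwarz_ineq2[of "x n" "y n"] by simp
  also have "\<dots> \<le> (norm (x n))\<^sup>2 + (norm (y n))\<^sup>2"
    using sum_squares_bound[of "norm (x n)" "norm (y n)"]
      mult_nonneg_nonneg[OF norm_ge_zero[of "x n"] norm_ge_zero[of "y n"]] by linarith
  finally show "norm (inner (x n) (y n)) \<le> (norm (x n))\<^sup>2 + (norm (y n))\<^sup>2" .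
qed

lemma sqsum_summable_cinner:
  fixes x y :: "nat \<Rightarrow> 'a::complex_inner"
  assumes "sqsum x" "sqsum y"
  shows "summable (\<lambda>n. cinner (x n) (y n))"
proof -
  have "(\<lambda>n. cinner (x n) (y n)) =
      (\<lambda>n. complex_of_real (inner (x n) (y n)) - \<i> * complex_of_real (inner (\<i> *\<^sub>C x n) (y n)))"
    by (subst cinner_eq_Complex_inner) (simp add: complex_eq_iff fun_eq_iff)
  then show ?thesis
    using assms
    by (auto intro!: summable_diff summable_mult summable_of_real sqsum_summable_inner sqsum_scaleC)
qed

typedef (overloaded) 'a l2seq = "{x :: nat \<Rightarrow> 'a::chilbert_space. sqsum x}"
  morphisms l2_nth Abs_l2seq
  using sqsum_zero by auto

setup_lifting type_definition_l2seq

lemma sqsum_l2_nth: "sqsum (l2_nth x)"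
  using l2_nth by auto

instantiation l2seq :: (chilbert_space) real_vector
begin

lift_definition zero_l2seq :: "'a l2seq" is "\<lambda>_. 0" by (rule sqsum_zero)
lift_definition plus_l2seq :: "'a l2seq \<Rightarrow> 'a l2seq \<Rightarrow> 'a l2seq" is "\<lambda>x y n. x n + y n"
  by (rule sqsum_add)
lift_definition minus_l2seq :: "'a l2seq \<Rightarrow> 'a l2seq \<Rightarrow> 'a l2seq" is "\<lambda>x y n. x n - y n"
  by (rule sqsum_diff)
lift_definition uminus_l2seq :: "'a l2seq \<Rightarrow> 'a l2seq" is "\<lambda>x n. - x n"
  by (rule sqsum_minus)
lift_definition scaleR_l2seq :: "real \<Rightarrow> 'a l2seq \<Rightarrow> 'a l2seq" is "\<lambda>r x n. r *\<^sub>R x n"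
  by (rule sqsum_scaleR)

instance
  by standard (transfer; simp add: algebra_simps)+

end

instantiation l2seq :: (chilbert_space) norm
begin
definition norm_l2seq :: "'a l2seq \<Rightarrow> real" where
  "norm x = sqrt (\<Sum>n. (norm (l2_nth x n))\<^sup>2)"
instance ..
end

instantiation l2seq :: (chilbert_space) sgn
begin
definition sgn_l2seq :: "'a l2seq \<Rightarrow> 'a l2seq" where
  "sgn x = inverse (sqrt (\<Sum>n. (norm (l2_nth x n))\<^sup>2)) *\<^sub>R x"
instance ..
end

instantiation l2seq :: (chilbert_space) dist
begin
definition dist_l2seq :: "'a l2seq \<Rightarrow> 'a l2seq \<Rightarrow> real" where
  "dist x y = sqrt (\<Sum>n. (norm (l2_nth (x - y) n))\<^sup>2)"
instance ..
end

instantiation l2seq :: (chilbert_space) uniformity_dist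
begin
definition [code del]:
  "(uniformity :: ('a l2seq \<times> 'a l2seq) filter) = (INF e\<in>{0<..}. principal {(x, y). dist x y < e})"
instance
  by standard (rule uniformity_l2seq_def)
end

instantiation l2seq :: (chilbert_space) open_uniformity
begin
definition [code del]:
  "open (U :: 'a l2seq set) \<longleftrightarrow> (\<forall>x\<in>U. \<forall>\<^sub>F (x', y) in uniformity. x' = x \<longrightarrow> y \<in> U)"
instance
  by standard (rule open_l2seq_def)
end

instantiation l2seq :: (chilbert_space) real_normed_vector
begin

instance
proof
  fix x y :: "'a l2seq" and a :: real
  have sm: "summable (\<lambda>n. (norm (l2_nth z n))\<^sup>2)" for z :: "'a l2seq"
    using sqsum_l2_nth[of z] by (simp add: sqsum_def)
  have part: "L2_set (\<lambda>n. norm (l2_nth z n)) {..<k} \<le> norm z" for z :: "'a l2seq" and k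
    unfolding L2_set_def norm_l2seq_def by (intro real_sqrt_le_mono sum_le_suminf sm) auto
  show "dist x y = norm (x - y)" by (simp add: dist_l2seq_def norm_l2seq_def)
  show "sgn x = inverse (norm x) *\<^sub>R x" by (simp add: sgn_l2seq_def norm_l2seq_def)
  show "norm x = 0 \<longleftrightarrow> x = 0"
  proof -
    have "norm x = 0 \<longleftrightarrow> (\<Sum>n. (norm (l2_nth x n))\<^sup>2) = 0" by (simp add: norm_l2seq_def)
    also have "\<dots> \<longleftrightarrow> (\<forall>n. (norm (l2_nth x n))\<^sup>2 = 0)" by (rule suminf_eq_zero_iff[OF sm]) simp
    also have "\<dots> \<longleftrightarrow> x = 0"
      by (simp add: l2_nth_inject[symmetric] zero_l2seq.rep_eq fun_eq_iff)
    finally show ?thesis .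
  qed
  show "norm (a *\<^sub>R x) = \<bar>a\<bar> * norm x"
    by (simp add: norm_l2seq_def scaleR_l2seq.rep_eq power_mult_distrib suminf_mult[OF sm]
          real_sqrt_mult)
  show "norm (x + y) \<le> norm x + norm y"
  proof -
    have "(\<Sum>n<k. (norm (l2_nth (x + y) n))\<^sup>2) \<le> (norm x + norm y)\<^sup>2" for k
    proof -
      have "L2_set (\<lambda>n. norm (l2_nth (x + y) n)) {..<k}
          \<le> L2_set (\<lambda>n. norm (l2_nth x n) + norm (l2_nth y n)) {..<k}"
        by (rule L2_set_mono) (auto simp: plus_l2seq.rep_eq norm_triangle_ineq)
      also have "\<dots> \<le> L2_set (\<lambda>n. norm (l2_nth x n)) {..<k} + L2_set (\<lambda>n. norm (l2_nth y n)) {..<k}"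
        by (rule L2_set_triangle_ineq)
      also have "\<dots> \<le> norm x + norm y" by (intro add_mono part)
      finally show ?thesis unfolding L2_set_def by (rule sqrt_le_D)
    qed
    then have "(\<Sum>n. (norm (l2_nth (x + y) n))\<^sup>2) \<le> (norm x + norm y)\<^sup>2"
      by (intro suminf_le_const sm)
    moreover have "0 \<le> norm x + norm y"
      using part[of x 0] part[of y 0] by simp
    ultimately show ?thesis
      unfolding norm_l2seq_def[of "x + y"] by (simp add: real_le_lsqrt)
  qed
qed

end

instantiation l2seq :: (chilbert_space) complex_inner
begin

lift_definition scaleC_l2seq :: "complex \<Rightarrow> 'a l2seq \<Rightarrow> 'a l2seq" is "\<lambda>c x n. c *\<^sub>C x n"
  by (rule sqsum_scaleC)

definition cinner_l2seq :: "'a l2seq \<Rightarrow> 'a l2seq \<Rightarrow> complex" where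
  "cinner x y = (\<Sum>n. cinner (l2_nth x n) (l2_nth y n))"

definition inner_l2seq :: "'a l2seq \<Rightarrow> 'a l2seq \<Rightarrow> real" where
  "inner x y = (\<Sum>n. inner (l2_nth x n) (l2_nth y n))"

instance
proof
  fix x y z :: "'a l2seq" and r :: real and c d :: complex
  note sm = sqsum_summable_inner[OF sqsum_l2_nth sqsum_l2_nth]
  note cm = sqsum_summable_cinner[OF sqsum_l2_nth sqsum_l2_nth]
  show "inner x y = inner y x" by (simp add: inner_l2seq_def inner_commute)
  show "inner (x + y) z = inner x z + inner y z"
    by (simp add: inner_l2seq_def plus_l2seq.rep_eq inner_add_left suminf_add[OF sm sm])
  show "inner (r *\<^sub>R x) y = r * inner x y"
    by (simp add: inner_l2seq_def scaleR_l2seq.rep_eq suminf_mult[OF sm])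
  have nrm: "inner x x = (norm x)\<^sup>2"
  proof -
    have "0 \<le> (\<Sum>n. inner (l2_nth x n) (l2_nth x n))" by (rule suminf_nonneg[OF sm]) simp
    then show ?thesis by (simp add: inner_l2seq_def norm_l2seq_def power2_norm_eq_inner)
  qed
  show "0 \<le> inner x x" and "inner x x = 0 \<longleftrightarrow> x = 0" and "norm x = sqrt (inner x x)"
    by (simp_all add: nrm)
  show "c *\<^sub>C (x + y) = c *\<^sub>C x + c *\<^sub>C y" by transfer (simp add: scaleC_add_right)
  show "(c + d) *\<^sub>C x = c *\<^sub>C x + d *\<^sub>C x" by transfer (simp add: scaleC_add_left)
  show "c *\<^sub>C d *\<^sub>C x = (c * d) *\<^sub>C x" by transfer (simp add: scaleC_scaleC)
  show "r *\<^sub>R x = complex_of_real r *\<^sub>C x" by transfer (simp add: scaleR_scaleC)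
  show "cinner x y = cnj (cinner y x)"
  proof -
    have "(\<lambda>n. cnj (cinner (l2_nth y n) (l2_nth x n))) sums cnj (cinner y x)"
      unfolding cinner_l2seq_def sums_cnj by (rule summable_sums[OF cm])
    then show ?thesis
      unfolding cinner_l2seq_def[of x y] by (simp add: cinner_commute[symmetric] sums_iff)
  qed
  show "cinner (x + y) z = cinner x z + cinner y z"
    by (simp add: cinner_l2seq_def plus_l2seq.rep_eq cinner_add_left suminf_add[OF cm cm])
  show "cinner (c *\<^sub>C x) y = c * cinner x y"
    by (simp add: cinner_l2seq_def scaleC_l2seq.rep_eq cinner_scaleC_left suminf_mult[OF cm])
  show "inner x y = Re (cinner x y)"
    by (simp add: cinner_l2seq_def inner_l2seq_def inner_eq_Re_cinner Re_suminf[OF cm])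
qed

end

lemma norm_l2seq_sq: "(norm x)\<^sup>2 = (\<Sum>n. (norm (l2_nth x n))\<^sup>2)" for x :: "'a::chilbert_space l2seq"
  by (simp add: power2_norm_eq_inner inner_l2seq_def)

lemma sum_norm_l2_nth_le: "(\<Sum>n<k. (norm (l2_nth x n))\<^sup>2) \<le> (norm x)\<^sup>2"
  for x :: "'a::chilbert_space l2seq"
  unfolding norm_l2seq_sq
  by (rule sum_le_suminf) (use sqsum_l2_nth[of x] in \<open>auto simp: sqsum_def\<close>)

lemma norm_l2_nth_le: "norm (l2_nth x n) \<le> norm x" for x :: "'a::chilbert_space l2seq"
proof -
  have "(norm (l2_nth x n))\<^sup>2 \<le> (\<Sum>j<Suc n. (norm (l2_nth x j))\<^sup>2)"
    by (simp add: sum_nonneg)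
  also have "\<dots> \<le> (norm x)\<^sup>2" by (rule sum_norm_l2_nth_le)
  finally show ?thesis by (simp add: power2_le_iff_abs_le)
qed

instance l2seq :: (chilbert_space) chilbert_space
proof
  fix X :: "nat \<Rightarrow> 'a l2seq"
  assume cau: "Cauchy X"
  have "Cauchy (\<lambda>m. l2_nth (X m) n)" for n
  proof (rule metric_CauchyI)
    fix e :: real assume "0 < e"
    then obtain M where M: "\<forall>i\<ge>M. \<forall>j\<ge>M. dist (X i) (X j) < e"
      using metric_CauchyD[OF cau] by blast
    have "dist (l2_nth (X i) n) (l2_nth (X j) n) < e" if "i \<ge> M" "j \<ge> M" for i j
    proof -
      have "dist (l2_nth (X i) n) (l2_nth (X j) n) = norm (l2_nth (X i - X j) n)"
        by (simp add: dist_norm minus_l2seq.rep_eq)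
      also have "\<dots> \<le> dist (X i) (X j)" unfolding dist_norm by (rule norm_l2_nth_le)
      finally show ?thesis using M that by fastforce
    qed
    then show "\<exists>M. \<forall>i\<ge>M. \<forall>j\<ge>M. dist (l2_nth (X i) n) (l2_nth (X j) n) < e" by blast
  qed
  then have "\<forall>n. \<exists>l. (\<lambda>m. l2_nth (X m) n) \<longlonglongrightarrow> l"
    using Cauchy_convergent_iff convergent_def by blast
  then obtain x where x: "(\<lambda>m. l2_nth (X m) n) \<longlonglongrightarrow> x n" for n by metis
  have tail: "(\<Sum>n<k. (norm (x n - l2_nth (X i) n))\<^sup>2) \<le> e\<^sup>2"
    if M: "\<forall>i\<ge>M. \<forall>j\<ge>M. dist (X i) (X j) < e" and i: "i \<ge> M" for M e i k
  proof (rule tendsto_upperbound)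
    show "(\<lambda>j. \<Sum>n<k. (norm (l2_nth (X j) n - l2_nth (X i) n))\<^sup>2)
        \<longlonglongrightarrow> (\<Sum>n<k. (norm (x n - l2_nth (X i) n))\<^sup>2)"
      by (intro tendsto_intros x)
    have "(\<Sum>n<k. (norm (l2_nth (X j) n - l2_nth (X i) n))\<^sup>2) \<le> e\<^sup>2" if "j \<ge> M" for j
    proof -
      have "(\<Sum>n<k. (norm (l2_nth (X j) n - l2_nth (X i) n))\<^sup>2) \<le> (norm (X j - X i))\<^sup>2"
        using sum_norm_l2_nth_le[of "X j - X i" k] by (simp add: minus_l2seq.rep_eq)
      also have "\<dots> \<le> e\<^sup>2"
        using M i that by (intro power_mono) (auto simp: dist_norm less_imp_le)
      finally show ?thesis .
    qed
    then show "\<forall>\<^sub>F j in sequentially. (\<Sum>n<k. (norm (l2_nth (X j) n - l2_nth (X i) n))\<^sup>2) \<le> e\<^sup>2"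
      by (auto simp: eventually_sequentially)
  qed simp
  have dif: "sqsum (\<lambda>n. x n - l2_nth (X i) n)"
    if M: "\<forall>i\<ge>M. \<forall>j\<ge>M. dist (X i) (X j) < e" and i: "i \<ge> M" for M e i
    unfolding sqsum_def
    by (rule summableI_nonneg_bounded[where x = "e\<^sup>2"]) (use tail[OF M i] in auto)
  obtain M where "\<forall>i\<ge>M. \<forall>j\<ge>M. dist (X i) (X j) < 1"
    using metric_CauchyD[OF cau, of 1] by auto
  then have "sqsum (\<lambda>n. (x n - l2_nth (X M) n) + l2_nth (X M) n)"
    by (intro sqsum_add dif sqsum_l2_nth) auto
  then have xs: "sqsum x" by simp
  define y where "y = Abs_l2seq x"
  have y: "l2_nth y = x" using xs by (simp add: y_def Abs_l2seq_inverse)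
  have "X \<longlonglongrightarrow> y"
  proof (rule metric_LIMSEQ_I)
    fix r :: real assume r: "0 < r"
    then obtain M where M: "\<forall>i\<ge>M. \<forall>j\<ge>M. dist (X i) (X j) < r / 2"
      using metric_CauchyD[OF cau, of "r / 2"] by auto
    have "dist (X i) y < r" if i: "i \<ge> M" for i
    proof -
      have "(norm (y - X i))\<^sup>2 \<le> (r / 2)\<^sup>2"
        unfolding norm_l2seq_sq
        using dif[OF M i] tail[OF M i]
        by (intro suminf_le_const) (auto simp: sqsum_def minus_l2seq.rep_eq y)
      then have "norm (y - X i) \<le> r / 2"
        using r by (simp add: power2_le_iff_abs_le)
      then show ?thesis using r by (simp add: dist_norm norm_minus_commute)
    qed
    then show "\<exists>no. \<forall>n\<ge>no. dist (X n) y < r" by blast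
  qed
  then show "convergent X" by (auto simp: convergent_def)
qed

section \<open>Operators on closed subspaces\<close>

text \<open>
  A Hilbert space is a closed complex subspace of a space of class \<open>chilbert_space\<close> (possibly all
  of it).  Operators on the subspace are functions on the ambient type of which only the values
  on the subspace matter.
\<close>

definition closed_csubspace :: "'a::chilbert_space set \<Rightarrow> bool" where
  "closed_csubspace S \<longleftrightarrow> 0 \<in> S \<and> (\<forall>x\<in>S. \<forall>y\<in>S. x + y \<in> S) \<and> (\<forall>c. \<forall>x\<in>S. c *\<^sub>C x \<in> S) \<and> closed S"

definition clinear_on :: "'a::chilbert_space set \<Rightarrow> ('a \<Rightarrow> 'b::chilbert_space) \<Rightarrow> bool" where
  "clinear_on S T \<longleftrightarrow> (\<forall>x\<in>S. \<forall>y\<in>S. T (x + y) = T x + T y) \<and> (\<forall>c. \<forall>x\<in>S. T (c *\<^sub>C x) = c *\<^sub>C T x)"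

definition bounded_op :: "'a::chilbert_space set \<Rightarrow> ('a \<Rightarrow> 'a) \<Rightarrow> bool" where
  "bounded_op S T \<longleftrightarrow> T ` S \<subseteq> S \<and> clinear_on S T \<and> (\<exists>B. \<forall>x\<in>S. norm (T x) \<le> B * norm x)"

definition contraction :: "'a::chilbert_space set \<Rightarrow> ('a \<Rightarrow> 'a) \<Rightarrow> bool" where
  "contraction S T \<longleftrightarrow> T ` S \<subseteq> S \<and> clinear_on S T \<and> (\<forall>x\<in>S. norm (T x) \<le> norm x)"

definition commuting_on :: "'a set \<Rightarrow> ('a \<Rightarrow> 'a) \<Rightarrow> ('a \<Rightarrow> 'a) \<Rightarrow> bool" where
  "commuting_on S T R \<longleftrightarrow> (\<forall>x\<in>S. T (R x) = R (T x))"

text \<open>The adjoint of a bounded operator on \<open>S\<close>; it exists uniquely by Riesz representation.\<close>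

definition adj_on :: "'a::chilbert_space set \<Rightarrow> ('a \<Rightarrow> 'a) \<Rightarrow> 'a \<Rightarrow> 'a" where
  "adj_on S T y = (THE z. z \<in> S \<and> (\<forall>x\<in>S. cinner (T x) y = cinner x z))"

definition normal_op :: "'a::chilbert_space set \<Rightarrow> ('a \<Rightarrow> 'a) \<Rightarrow> bool" where
  "normal_op S T \<longleftrightarrow> bounded_op S T \<and> commuting_on S T (adj_on S T)"

definition isometric_embedding ::
  "'a::chilbert_space set \<Rightarrow> 'b::chilbert_space set \<Rightarrow> ('a \<Rightarrow> 'b) \<Rightarrow> bool" where
  "isometric_embedding S L J \<longleftrightarrow> J ` S \<subseteq> L \<and> clinear_on S J \<and> (\<forall>x\<in>S. norm (J x) = norm x)"

section \<open>Taylor joint spectrum\<close>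

text \<open>
  Elements of \<open>S \<otimes> \<Lambda>(\<complex>\<^sup>n)\<close> are families \<open>f\<close> of vectors of \<open>S\<close> indexed by the subsets of
  \<open>{..<n}\<close>: \<open>f A\<close> is the coefficient of \<open>e\<^sub>A = e\<^sub>i\<^sub>1 \<and> \<dots> \<and> e\<^sub>i\<^sub>p\<close> for \<open>A = {i\<^sub>1 < \<dots> < i\<^sub>p}\<close>.  The
  Koszul differential of \<open>Ts - xs\<close> maps \<open>v \<otimes> e\<^sub>B\<close> to
  \<open>\<Sum>i. (T\<^sub>i v - x\<^sub>i v) \<otimes> (e\<^sub>i \<and> e\<^sub>B)\<close>.  As it raises the degree by one, exactness in every degree
  is the same as exactness of the total complex.
\<close>

definition koszul_diff ::
  "('a::chilbert_space \<Rightarrow> 'a) list \<Rightarrow> complex list \<Rightarrow> (nat set \<Rightarrow> 'a) \<Rightarrow> nat set \<Rightarrow> 'a" where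
  "koszul_diff Ts xs f A =
     (\<Sum>i\<in>A. (-1) ^ card {j \<in> A. j < i} *\<^sub>R ((Ts ! i) (f (A - {i})) - xs ! i *\<^sub>C f (A - {i})))"

definition koszul_exact ::
  "'a::chilbert_space set \<Rightarrow> ('a \<Rightarrow> 'a) list \<Rightarrow> complex list \<Rightarrow> bool" where
  "koszul_exact S Ts xs \<longleftrightarrow>
     (\<forall>f \<in> Pow {..<length Ts} \<rightarrow> S.
        (\<forall>A\<subseteq>{..<length Ts}. koszul_diff Ts xs f A = 0) \<longrightarrow>
        (\<exists>g \<in> Pow {..<length Ts} \<rightarrow> S. \<forall>A\<subseteq>{..<length Ts}. f A = koszul_diff Ts xs g A))"

definition taylor_spectrum ::
  "'a::chilbert_space set \<Rightarrow> ('a \<Rightarrow> 'a) list \<Rightarrow> complex list set" where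
  "taylor_spectrum S Ts = {xs. length xs = length Ts \<and> \<not> koszul_exact S Ts xs}"

section \<open>The domain\<close>

text \<open>The norm on \<open>complex ^ 'n\<close> is the Hermitian one, so \<open>onorm\<close> is the usual operator norm.\<close>

definition mu :: "(complex ^ 'n ^ 'n) set \<Rightarrow> complex ^ 'n ^ 'n \<Rightarrow> real" where
  "mu E A =
     (if \<exists>X\<in>E. det (mat 1 - A ** X) = 0
      then 1 / Inf {onorm (\<lambda>v. X *v v) | X. X \<in> E \<and> det (mat 1 - A ** X) = 0}
      else 0)"

definition E_33111 :: "(complex ^ 3 ^ 3) set" where
  "E_33111 = {X. \<forall>i j. i \<noteq> j \<longrightarrow> X $ i $ j = 0}"

text \<open>Points of \<open>\<complex>\<^sup>7\<close> and 7-tuples of operators are lists of length 7.\<close>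

definition Gamma_E :: "complex list set" where
  "Gamma_E =
     {[A$1$1,
       A$2$2,
       A$1$1 * A$2$2 - A$1$2 * A$2$1,
       A$3$3,
       A$1$1 * A$3$3 - A$1$3 * A$3$1,
       A$2$2 * A$3$3 - A$2$3 * A$3$2,
       det A] | A :: complex ^ 3 ^ 3. mu E_33111 A \<le> 1}"

definition K_E :: "complex list set" where
  "K_E =
     {[x1, x2, x3, x4, x5, x6, x7] | x1 x2 x3 x4 x5 x6 x7.
        [x1, x2, x3, x4, x5, x6, x7] \<in> Gamma_E \<and>
        x1 = cnj x6 * x7 \<and> x3 = cnj x4 * x7 \<and> x5 = cnj x2 * x7 \<and> norm x7 = 1}"

section \<open>Unitaries, isometries and dilations\<close>

definition Gamma_unitary :: "'a::chilbert_space set \<Rightarrow> ('a \<Rightarrow> 'a) list \<Rightarrow> bool" where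
  "Gamma_unitary L Ns \<longleftrightarrow>
     length Ns = 7 \<and> (\<forall>N\<in>set Ns. normal_op L N) \<and>
     (\<forall>N\<in>set Ns. \<forall>N'\<in>set Ns. commuting_on L N N') \<and> taylor_spectrum L Ns \<subseteq> K_E"

text \<open>
  The space \<open>L\<close> of the unitary contains the space \<open>M\<close> of the isometry up to an isometric embedding
  \<open>J\<close>, whose range is a closed subspace; the intertwining relation says that this range is
  invariant and that the restriction of \<open>Ns\<close> to it is \<open>Vs\<close>.  Passing to the smallest reducing
  subspace of the unitary containing \<open>M\<close>, one can always take \<open>L\<close> to have Hilbert dimension at
  most \<open>\<aleph>\<^sub>0\<close> times that of \<open>M\<close>, so that it fits into the square-summable sequences.
\<close>

definition Gamma_isometry :: "'a::chilbert_space set \<Rightarrow> ('a \<Rightarrow> 'a) list \<Rightarrow> bool" where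
  "Gamma_isometry M Vs \<longleftrightarrow>
     length Vs = 7 \<and> (\<forall>V\<in>set Vs. V ` M \<subseteq> M) \<and>
     (\<exists>(L :: 'a l2seq set) Ns J.
        closed_csubspace L \<and> Gamma_unitary L Ns \<and> isometric_embedding M L J \<and>
        (\<forall>i<7. \<forall>x\<in>M. (Ns ! i) (J x) = J ((Vs ! i) x)))"

text \<open>
  Similarly \<open>H\<close> is identified with its image in the dilation space \<open>M\<close>, and the dilation space can
  always be cut down to the closed span of the vectors \<open>V\<^sub>1\<^sup>n\<^sup>1 \<dots> V\<^sub>7\<^sup>n\<^sup>7 h\<close>, which fits into the
  square-summable sequences.
\<close>

definition has_Gamma_isometric_dilation ::
  "'a::chilbert_space set \<Rightarrow> ('a \<Rightarrow> 'a) list \<Rightarrow> bool" where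
  "has_Gamma_isometric_dilation H Xs \<longleftrightarrow>
     (\<exists>(M :: 'a l2seq set) Vs J.
        closed_csubspace M \<and> Gamma_isometry M Vs \<and> isometric_embedding H M J \<and>
        (\<forall>i<7. \<forall>h\<in>H. adj_on M (Vs ! i) (J h) = J (adj_on H (Xs ! i) h)))"

end

theory Submission
  imports Defs
begin

text \<open>
  For scalars \<open>u\<close>, \<open>v\<close>, the point \<open>(u, v, uv, uv, u\<^sup>2v, uv\<^sup>2, u\<^sup>2v\<^sup>2)\<close> lists the principal minors of the
  matrix \<open>diag(u, v, uv)\<close>, and for \<open>u\<close>, \<open>v\<close> on the unit circle it lies in \<open>K\<close> (lemma \<open>torus_in_K_E\<close>).
  Hence a pair of commuting unitaries \<open>(U\<^sub>1, U\<^sub>2)\<close> gives a \<open>\<Gamma>\<close>-unitary by the same seven monomials: at a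
  point of the joint spectrum, the monomial relations between the operators hold between the
  coordinates and the coordinates are unimodular (\<open>monomials_unitary\<close>).  So it suffices to dilate
  \<open>(T\<^sub>1, T\<^sub>2)\<close> to commuting isometries \<open>(V\<^sub>1, V\<^sub>2)\<close> and to extend these to commuting unitaries: adjoints
  and restrictions are multiplicative, so both steps carry over to the seven monomials.
  
  The dilation is Ando's theorem (\<open>ando_isometric_dilation\<close>), on the space of square-summable
  sequences over \<open>H\<close>, whose first coordinate is \<open>H\<close>.  Two points differ from the usual proof.  The defect
  operator \<open>D\<close> of a contraction, \<open>\<parallel>Dh\<parallel>\<^sup>2 = \<parallel>h\<parallel>\<^sup>2 - \<parallel>Th\<parallel>\<^sup>2\<close>, takes values in the sequences over \<open>H\<close>; this
  replaces the square root of \<open>1 - T\<^sup>*T\<close> by a telescoping series (\<open>defect_operator_exists\<close>).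
  The two naive isometric dilations \<open>W\<^sub>1\<close>, \<open>W\<^sub>2\<close> fail to commute, and a unitary \<open>R\<close> that carries the defect
  of \<open>W\<^sub>1W\<^sub>2\<close> to the defect of \<open>W\<^sub>2W\<^sub>1\<close> repairs this.  As the two defects have the same Gram matrix and
  are placed in orthogonal subspaces, \<open>R\<close> can be chosen as a reflection, without any comparison of
  dimensions (\<open>reflection_exists\<close>).
  
  The unitary extension (\<open>commuting_isometries_unitary_extension\<close>) is a second use of Ando's theorem,
  for the adjoints \<open>V\<^sub>1\<^sup>*\<close>, \<open>V\<^sub>2\<^sup>*\<close>: if the isometries \<open>X\<^sub>1\<close>, \<open>X\<^sub>2\<close> dilate them, then \<open>X\<^sub>i\<^sup>*\<close> extends \<open>V\<^sub>i\<close>, and on the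
  unitary part of \<open>X\<^sub>1X\<^sub>2\<close>, which contains the original space, \<open>X\<^sub>i\<close> is invertible and its inverse
  extends \<open>V\<^sub>i\<close>.
  
  For the Taylor spectrum only one general fact is used: if \<open>\<Sum>(T\<^sub>i - x\<^sub>i)B\<^sub>i = 1\<close> with \<open>B\<^sub>i\<close> commuting
  with all \<open>T\<^sub>j\<close>, then the Koszul complex at \<open>x\<close> is exact (\<open>koszul_exact_of_bezout\<close>).
\<close>

section \<open>Complex linear maps\<close>

lemma scaleC_zero_left: "0 *\<^sub>C x = 0" for x :: "'a::complex_inner"
  using scaleR_scaleC[of 0 x] by simp

lemma scaleC_one: "1 *\<^sub>C x = x" for x :: "'a::complex_inner"
  using scaleR_scaleC[of 1 x] by simp

lemma scaleC_zero [simp]: "c *\<^sub>C 0 = (0 :: 'a::complex_inner)"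
  by (metis norm_eq_zero norm_scaleC mult_zero_right norm_zero)

lemma scaleC_diff_right: "c *\<^sub>C (x - y) = c *\<^sub>C x - c *\<^sub>C y" for x y :: "'a::complex_inner"
  using scaleC_add_right[of c "x - y" y] by simp

lemma scaleC_minus_left: "(- c) *\<^sub>C x = - (c *\<^sub>C x)" for x :: "'a::complex_inner"
  using scaleC_add_left[of c "-c" x] scaleR_scaleC[of 0 x]
  by (simp add: eq_neg_iff_add_eq_0 add.commute)

lemma scaleC_diff_left: "(c - d) *\<^sub>C x = c *\<^sub>C x - d *\<^sub>C x" for x :: "'a::complex_inner"
  using scaleC_add_left[of "c - d" d x] by simp

lemma closed_csubspace_diff:
  assumes "closed_csubspace S" "x \<in> S" "y \<in> S"
  shows "x - y \<in> S"
proof -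
  have "x + (- 1) *\<^sub>C y \<in> S" using assms by (simp add: closed_csubspace_def)
  then show ?thesis by (simp add: scaleC_minus_left scaleC_one)
qed

lemma inner_ext: "(\<And>x. inner x y = inner x z) \<Longrightarrow> y = z" for y z :: "'a::real_inner"
  by (metis inner_diff_right inner_eq_zero_iff right_minus_eq)

lemma inner_scaleC_left: "inner (c *\<^sub>C x) y = inner x (cnj c *\<^sub>C y)" for x y :: "'a::complex_inner"
proof -
  have "cinner x (cnj c *\<^sub>C y) = cnj (cnj c * cinner y x)"
    by (subst cinner_commute) (simp only: cinner_scaleC_left)
  also have "\<dots> = c * cinner x y" by (simp add: cinner_commute[of x y])
  finally show ?thesis by (simp add: inner_eq_Re_cinner cinner_scaleC_left)
qed

lemma clinear_linear: "clinear_on UNIV T \<Longrightarrow> linear T"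
  by (auto simp: clinear_on_def scaleR_scaleC intro!: linearI)

lemma clinear_scaleC: "clinear_on UNIV T \<Longrightarrow> T (c *\<^sub>C x) = c *\<^sub>C T x"
  by (simp add: clinear_on_def)

lemma clinear_comp: "clinear_on UNIV f \<Longrightarrow> clinear_on UNIV g \<Longrightarrow> clinear_on UNIV (\<lambda>x. f (g x))"
  by (simp add: clinear_on_def)

lemma clinear_add: "clinear_on UNIV f \<Longrightarrow> clinear_on UNIV g \<Longrightarrow> clinear_on UNIV (\<lambda>x. f x + g x)"
  by (simp add: clinear_on_def scaleC_add_right algebra_simps)

lemma contraction_linear: "contraction UNIV T \<Longrightarrow> linear T"
  by (simp add: contraction_def clinear_linear)

section \<open>Riesz representation and adjoints\<close>

text \<open>
  A minimizing sequence for the distance from \<open>x\<close> to \<open>S\<close> is Cauchy by the parallelogram law; its limit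
  is the nearest point, and moving from it along a vector of \<open>S\<close> cannot decrease the distance.
\<close>

lemma orthogonal_projection_exists:
  fixes S :: "'a::{real_inner,complete_space} set"
  assumes S: "subspace S" "closed S"
  shows "\<exists>p\<in>S. \<forall>s\<in>S. inner (x - p) s = 0"
proof -
  define d where "d = Inf ((\<lambda>s. (norm (x - s))\<^sup>2) ` S)"
  have ne: "S \<noteq> {}" using subspace_0[OF S(1)] by blast
  have bb: "bdd_below ((\<lambda>s. (norm (x - s))\<^sup>2) ` S)"
    by (rule bdd_belowI2[of _ 0]) simp
  have d_le: "d \<le> (norm (x - s))\<^sup>2" if "s \<in> S" for s
    unfolding d_def using bb that by (rule cINF_lower)
  \<comment> \<open>a minimizing sequence\<close>
  have "\<exists>s\<in>S. (norm (x - s))\<^sup>2 < d + 1 / Suc n" for n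
  proof -
    have "d < d + 1 / Suc n" by simp
    then show ?thesis using cINF_less_iff[OF ne bb] unfolding d_def by blast
  qed
  then obtain s where s: "s n \<in> S" "(norm (x - s n))\<^sup>2 < d + 1 / Suc n" for n by metis
  have par: "(norm (u - v))\<^sup>2 \<le> 2 * (norm (x - u))\<^sup>2 + 2 * (norm (x - v))\<^sup>2 - 4 * d"
    if "u \<in> S" "v \<in> S" for u v
  proof -
    have "(1/2) *\<^sub>R (u + v) \<in> S" using that S(1) by (simp add: subspace_add subspace_scale)
    from d_le[OF this] have "4 * d \<le> (norm (2 *\<^sub>R (x - (1/2) *\<^sub>R (u + v))))\<^sup>2"
      by (simp add: power_mult_distrib)
    also have "2 *\<^sub>R (x - (1/2) *\<^sub>R (u + v)) = (x - u) + (x - v)"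
      by (simp add: algebra_simps scaleR_2)
    finally show ?thesis
      by (simp add: power2_norm_eq_inner inner_diff_left inner_diff_right inner_add_left
          inner_add_right inner_commute)
  qed
  have "Cauchy s"
  proof (rule CauchyI)
    fix e :: real assume e: "0 < e"
    obtain N where N: "4 / e\<^sup>2 < real N" using reals_Archimedean2 by blast
    have "norm (s m - s n) < e" if "m \<ge> N" "n \<ge> N" for m n
    proof -
      have "0 < 4 / e\<^sup>2" using e by simp
      then have "N > 0" using N by (cases N) auto
      have "1 / real (Suc m) \<le> 1 / real N" "1 / real (Suc n) \<le> 1 / real N"
        using that \<open>N > 0\<close> by (auto intro!: divide_left_mono)
      moreover have "4 / real N < e\<^sup>2"
        using N e \<open>N > 0\<close> by (simp add: field_simps)
      ultimately have "(norm (s m - s n))\<^sup>2 < e\<^sup>2"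
        using par[OF s(1)[of m] s(1)[of n]] s(2)[of m] s(2)[of n] by (simp del: of_nat_Suc)
      then show ?thesis using e power2_less_imp_less by fastforce
    qed
    then show "\<exists>M. \<forall>m\<ge>M. \<forall>n\<ge>M. norm (s m - s n) < e" by blast
  qed
  then obtain p where p: "s \<longlonglongrightarrow> p" using Cauchy_convergent_iff convergent_def by blast
  have pS: "p \<in> S" using S(2) p s(1) closed_sequentially by blast
  have "(norm (x - p))\<^sup>2 \<le> d"
  proof (rule LIMSEQ_le)
    show "(\<lambda>n. (norm (x - s n))\<^sup>2) \<longlonglongrightarrow> (norm (x - p))\<^sup>2" by (intro tendsto_intros p)
    have "(\<lambda>n. d + 1 / Suc n) \<longlonglongrightarrow> d + 0"
      by (intro tendsto_add tendsto_const LIMSEQ_Suc[OF lim_1_over_n])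
    then show "(\<lambda>n. d + 1 / Suc n) \<longlonglongrightarrow> d" by simp
    show "\<exists>N. \<forall>n\<ge>N. (norm (x - s n))\<^sup>2 \<le> d + 1 / real (Suc n)"
      using s(2) less_imp_le by blast
  qed
  have "inner (x - p) v = 0" if v: "v \<in> S" for v
  proof (cases "v = 0")
    case False
    \<comment> \<open>The step of this length along \<open>v\<close> is the one that decreases the distance most.\<close>
    define t where "t = inner (x - p) v / (norm v)\<^sup>2"
    have nv: "(norm v)\<^sup>2 > 0" using False by simp
    have pt: "p + t *\<^sub>R v \<in> S" using pS v S(1) by (simp add: subspace_add subspace_scale)
    have "(norm (x - p))\<^sup>2 \<le> (norm (x - (p + t *\<^sub>R v)))\<^sup>2"
      using \<open>(norm (x - p))\<^sup>2 \<le> d\<close> d_le[OF pt] by (rule order_trans)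
    also have "\<dots> = (norm ((x - p) - t *\<^sub>R v))\<^sup>2"
      by (simp only: diff_diff_eq)
    also have "\<dots> = (norm (x - p))\<^sup>2 - 2 * t * inner (x - p) v + t\<^sup>2 * (norm v)\<^sup>2"
      unfolding power2_norm_eq_inner inner_diff_left inner_diff_right
      by (simp add: inner_commute power2_eq_square algebra_simps)
    also have "t\<^sup>2 * (norm v)\<^sup>2 = t * inner (x - p) v"
      using nv by (simp add: t_def power2_eq_square)
    finally have "t * inner (x - p) v \<le> 0" by simp
    then have "(inner (x - p) v)\<^sup>2 \<le> 0"
      using nv False by (auto simp: t_def divide_le_0_iff power2_eq_square mult_le_0_iff)
    then show ?thesis by simp
  qed simp
  with pS show ?thesis by blast
qed

lemma riesz_representation:
  fixes f :: "'a::{real_inner,complete_space} \<Rightarrow> real"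
  assumes f: "bounded_linear f"
  shows "\<exists>z. \<forall>x. f x = inner x z"
proof (cases "\<forall>x. f x = 0")
  case False
  then obtain x0 where x0: "f x0 \<noteq> 0" by blast
  interpret f: bounded_linear f by fact
  let ?S = "{x. f x = 0}"
  have "subspace ?S" by (simp add: f.add f.scaleR f.zero subspace_def)
  moreover have "closed ?S"
    by (intro closed_Collect_eq continuous_intros linear_continuous_on f)
  ultimately obtain p where p: "p \<in> ?S" "\<forall>s\<in>?S. inner (x0 - p) s = 0"
    using orthogonal_projection_exists by blast
  define u where "u = x0 - p"
  have fu: "f u \<noteq> 0" using p x0 by (simp add: u_def f.diff)
  have u0: "inner u u \<noteq> 0" using fu f.zero by auto
  have "f x = inner x ((f u / inner u u) *\<^sub>R u)" for x
  proof -
    have "x - (f x / f u) *\<^sub>R u \<in> ?S" using fu by (simp add: f.diff f.scaleR)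
    then have "inner u (x - (f x / f u) *\<^sub>R u) = 0" using p(2) unfolding u_def by blast
    then have "inner x u = f x / f u * inner u u" by (simp add: inner_diff_right inner_commute)
    then show ?thesis using u0 fu by (simp add: field_simps)
  qed
  then show ?thesis by blast
qed (auto intro!: exI[of _ 0])

lemma adjoint_exists:
  fixes T :: "'a::{real_inner,complete_space} \<Rightarrow> 'b::real_inner"
  assumes T: "bounded_linear T"
  shows "\<exists>T'. \<forall>x y. inner (T x) y = inner x (T' y)"
proof -
  have "\<exists>z. \<forall>x. inner (T x) y = inner x z" for y
    by (rule riesz_representation) (rule bounded_linear_inner_left_comp[OF T])
  then show ?thesis by metis
qed

lemma contraction_adjoint:
  fixes T :: "'a::chilbert_space \<Rightarrow> 'a"
  assumes T: "contraction UNIV T"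
  shows "\<exists>T'. contraction UNIV T' \<and> (\<forall>x y. inner (T x) y = inner x (T' y))"
proof -
  have "bounded_linear T"
    using T unfolding contraction_def
    by (intro bounded_linear_intro[where K = 1] linear_add linear_scale clinear_linear) auto
  from adjoint_exists[OF this] obtain T' where T': "inner (T x) y = inner x (T' y)" for x y
    by blast
  have "T' (x + y) = T' x + T' y" for x y
    by (rule inner_ext) (simp add: T'[symmetric] inner_add_right)
  moreover have "T' (c *\<^sub>C x) = c *\<^sub>C T' x" for c x
  proof (rule inner_ext)
    fix z
    have "inner z (T' (c *\<^sub>C x)) = inner (cnj c *\<^sub>C T z) x"
      by (simp add: T'[symmetric] inner_scaleC_left)
    also have "\<dots> = inner (T (cnj c *\<^sub>C z)) x"
      using T by (simp only: contraction_def clinear_scaleC[of T])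
    also have "\<dots> = inner z (c *\<^sub>C T' x)" by (simp add: T' inner_scaleC_left)
    finally show "inner z (T' (c *\<^sub>C x)) = inner z (c *\<^sub>C T' x)" .
  qed
  moreover have "norm (T' x) \<le> norm x" for x
  proof (cases "T' x = 0")
    case False
    have "(norm (T' x))\<^sup>2 = inner (T (T' x)) x" by (simp add: power2_norm_eq_inner T')
    also have "\<dots> \<le> norm (T (T' x)) * norm x" by (rule norm_cauchy_schwarz)
    also have "\<dots> \<le> norm (T' x) * norm x"
      using T unfolding contraction_def by (intro mult_right_mono) simp_all
    finally show ?thesis using False by (simp add: power2_eq_square)
  qed simp
  ultimately have "contraction UNIV T'" by (simp add: contraction_def clinear_on_def)
  then show ?thesis using T' by blast
qed

lemma cinner_eqI:
  fixes T :: "'a::chilbert_space \<Rightarrow> 'b::chilbert_space"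
  assumes "\<And>x. x \<in> S \<Longrightarrow> inner (T x) y = inner x z" "x \<in> S"
    and "\<And>c x. x \<in> S \<Longrightarrow> c *\<^sub>C x \<in> S" "\<And>c x. x \<in> S \<Longrightarrow> T (c *\<^sub>C x) = c *\<^sub>C T x"
  shows "cinner (T x) y = cinner x z"
proof -
  have "inner (T (\<i> *\<^sub>C x)) y = inner (\<i> *\<^sub>C x) z" by (rule assms(1)[OF assms(3)[OF assms(2)]])
  then have "inner (\<i> *\<^sub>C T x) y = inner (\<i> *\<^sub>C x) z" by (simp only: assms(4)[OF assms(2)])
  then show ?thesis using assms(1)[OF assms(2)] by (simp only: cinner_eq_Complex_inner)
qed

text \<open>
  Adjoints can be identified with the real inner product alone: for a complex linear operator on a
  complex subspace, the imaginary part of the complex identity is the real identity at \<open>\<i> x\<close>.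
\<close>

lemma adj_on_eqI:
  assumes S: "closed_csubspace S" and T: "clinear_on S T" and z: "z \<in> S"
    and adj: "\<And>x. x \<in> S \<Longrightarrow> inner (T x) y = inner x z"
  shows "adj_on S T y = z"
  unfolding adj_on_def
proof (rule the_equality)
  have SC: "\<And>c x. x \<in> S \<Longrightarrow> c *\<^sub>C x \<in> S" using S by (simp add: closed_csubspace_def)
  have TC: "\<And>c x. x \<in> S \<Longrightarrow> T (c *\<^sub>C x) = c *\<^sub>C T x" using T by (simp add: clinear_on_def)
  show "z \<in> S \<and> (\<forall>x\<in>S. cinner (T x) y = cinner x z)"
    using z cinner_eqI[OF adj _ SC TC] by blast
  fix w assume w: "w \<in> S \<and> (\<forall>x\<in>S. cinner (T x) y = cinner x w)"
  then have d: "w - z \<in> S" using S z by (simp add: closed_csubspace_diff)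
  have "inner (w - z) w = inner (w - z) z"
    using w d adj[OF d] by (simp add: inner_eq_Re_cinner)
  then have "inner (w - z) (w - z) = 0" by (simp add: inner_diff_right)
  then show "w = z" by simp
qed

section \<open>Isometries\<close>

definition cisometry :: "('a::chilbert_space \<Rightarrow> 'b::chilbert_space) \<Rightarrow> bool" where
  "cisometry V \<longleftrightarrow> clinear_on UNIV V \<and> (\<forall>x. norm (V x) = norm x)"

lemma inner_via_norm: "inner x y = ((norm (x + y))\<^sup>2 - (norm x)\<^sup>2 - (norm y)\<^sup>2) / 2"
  for x y :: "'a::real_inner"
  by (simp add: power2_norm_eq_inner inner_add_left inner_add_right inner_commute)

lemma cisometry_linear: "cisometry V \<Longrightarrow> linear V"
  by (simp add: cisometry_def clinear_linear)

lemma cisometry_inner: "cisometry V \<Longrightarrow> inner (V x) (V y) = inner x y"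
  using cisometry_linear[of V] unfolding inner_via_norm
  by (simp add: linear_add[symmetric]) (simp add: cisometry_def)

lemma cisometryI:
  assumes "clinear_on UNIV V" "\<And>x. inner (V x) (V x) = inner x x"
  shows "cisometry V"
  using assms by (simp add: cisometry_def norm_eq_sqrt_inner)

lemma cisometry_comp: "cisometry V \<Longrightarrow> cisometry W \<Longrightarrow> cisometry (V \<circ> W)"
  by (simp add: cisometry_def clinear_on_def)

lemma cisometry_inj: "cisometry V \<Longrightarrow> inj V"
  by (simp add: linear_injective_0[OF cisometry_linear]) (metis cisometry_def norm_eq_zero)

lemma cisometry_bounded_linear: "cisometry V \<Longrightarrow> bounded_linear V"
  using cisometry_linear[of V]
  by (intro bounded_linear_intro[where K = 1]) (auto simp: linear_iff cisometry_def)

lemma cisometry_funpow: "cisometry V \<Longrightarrow> cisometry (V ^^ n)" for V :: "'a::chilbert_space \<Rightarrow> 'a"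
  by (induction n) (auto simp: cisometry_def clinear_on_def)

section \<open>Square-summable sequences\<close>

lift_definition l2_cons :: "'a::chilbert_space \<Rightarrow> 'a l2seq \<Rightarrow> 'a l2seq" is
  "\<lambda>h g n. case n of 0 \<Rightarrow> h | Suc m \<Rightarrow> g m"
  by (subst (asm) sqsum_def, subst sqsum_def, subst summable_Suc_iff[symmetric]) simp

lift_definition l2_tl :: "'a::chilbert_space l2seq \<Rightarrow> 'a l2seq" is "\<lambda>f n. f (Suc n)"
proof -
  fix f :: "nat \<Rightarrow> 'a" assume "sqsum f"
  then show "sqsum (\<lambda>n. f (Suc n))"
    using summable_Suc_iff[of "\<lambda>n. (norm (f n))\<^sup>2"] by (simp add: sqsum_def)
qed

definition l2_hd :: "'a::chilbert_space l2seq \<Rightarrow> 'a" where "l2_hd f = l2_nth f 0"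

lemma l2_eqI: "(\<And>n. l2_nth f n = l2_nth g n) \<Longrightarrow> f = g" for f g :: "'a::chilbert_space l2seq"
  by (simp add: l2_nth_inject[symmetric] fun_eq_iff)

lemma l2_hd_cons [simp]: "l2_hd (l2_cons h g) = h"
  by (simp add: l2_hd_def l2_cons.rep_eq)

lemma l2_tl_cons [simp]: "l2_tl (l2_cons h g) = g"
  by (rule l2_eqI) (simp add: l2_cons.rep_eq l2_tl.rep_eq)

lemma l2_cons_add: "l2_cons (h + k) (f + g) = l2_cons h f + l2_cons k g"
  by (rule l2_eqI) (simp add: l2_cons.rep_eq plus_l2seq.rep_eq split: nat.split)

lemma l2_cons_scaleC: "l2_cons (c *\<^sub>C h) (c *\<^sub>C f) = c *\<^sub>C l2_cons h f"
  by (rule l2_eqI) (simp add: l2_cons.rep_eq scaleC_l2seq.rep_eq split: nat.split)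

lemma clinear_l2_hd: "clinear_on UNIV l2_hd"
  by (simp add: clinear_on_def l2_hd_def plus_l2seq.rep_eq scaleC_l2seq.rep_eq)

lemma clinear_l2_tl: "clinear_on UNIV l2_tl"
  by (auto simp: clinear_on_def l2_tl.rep_eq plus_l2seq.rep_eq scaleC_l2seq.rep_eq intro!: l2_eqI)

lemma inner_hd_tl: "inner f g = inner (l2_hd f) (l2_hd g) + inner (l2_tl f) (l2_tl g)"
  unfolding inner_l2seq_def l2_hd_def l2_tl.rep_eq
  by (rule suminf_split_head[OF sqsum_summable_inner[OF sqsum_l2_nth sqsum_l2_nth], THEN eq_diff_eq[THEN iffD1], 
      unfolded add.commute[of "suminf _"], symmetric])

lemma inner_cons: "inner (l2_cons h f) (l2_cons k g) = inner h k + inner f g"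
  by (subst inner_hd_tl) simp

lemma inner_cons_zero: "inner f (l2_cons h 0) = inner (l2_hd f) h"
  by (subst inner_hd_tl) simp

lemma cisometry_cons_zero: "cisometry (\<lambda>h. l2_cons h 0)"
proof (rule cisometryI)
  show "clinear_on UNIV (\<lambda>h. l2_cons h (0 :: 'a l2seq))"
    unfolding clinear_on_def l2_cons_add[of _ _ 0 0, simplified] l2_cons_scaleC[of _ _ 0, simplified]
    by simp
qed (simp add: inner_cons)

lemma sums_spread:
  fixes c :: "nat \<Rightarrow> 'b::real_normed_vector"
  assumes "r < 3"
  shows "(\<lambda>n. if n mod 3 = r then c (n div 3) else 0) sums x \<longleftrightarrow> c sums x"
proof -
  have "strict_mono (\<lambda>n. 3 * n + r)" by (simp add: strict_mono_def)
  moreover have "(if n mod 3 = r then c (n div 3) else 0) = 0" if "n \<notin> range (\<lambda>n. 3 * n + r)" for n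
  proof -
    have "n = 3 * (n div 3) + r" if "n mod 3 = r" using that by presburger
    then have "n mod 3 \<noteq> r" using \<open>n \<notin> _\<close> by blast
    then show ?thesis by simp
  qed
  ultimately show ?thesis
    using sums_mono_reindex[of "\<lambda>n. 3 * n + r" "\<lambda>n. if n mod 3 = r then c (n div 3) else 0" x] assms by simp
qed

text \<open>
  The maps \<open>spread 0\<close>, \<open>spread 1\<close>, \<open>spread 2\<close> are isometries of the sequence space into itself with
  mutually orthogonal ranges: they make room for two defect spaces and for a shift inside a
  single sequence space.
\<close>

definition spread :: "nat \<Rightarrow> 'a::chilbert_space l2seq \<Rightarrow> 'a l2seq" where
  "spread r f = Abs_l2seq (\<lambda>n. if n mod 3 = r then l2_nth f (n div 3) else 0)"

lemma l2_nth_spread: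
  assumes "r < 3"
  shows "l2_nth (spread r f) n = (if n mod 3 = r then l2_nth f (n div 3) else 0)"
proof -
  have eq: "(norm (if n mod 3 = r then l2_nth f (n div 3) else 0))\<^sup>2
      = (if n mod 3 = r then (norm (l2_nth f (n div 3)))\<^sup>2 else 0)" for n
    by simp
  have "sqsum (\<lambda>n. if n mod 3 = r then l2_nth f (n div 3) else 0)"
    using sqsum_l2_nth[of f] sums_spread[OF assms, of "\<lambda>n. (norm (l2_nth f n))\<^sup>2"]
    unfolding sqsum_def eq summable_def by blast
  then show ?thesis by (simp add: spread_def Abs_l2seq_inverse)
qed

lemma clinear_spread: "r < 3 \<Longrightarrow> clinear_on UNIV (spread r)"
  unfolding clinear_on_def
  by (auto simp: l2_nth_spread plus_l2seq.rep_eq scaleC_l2seq.rep_eq intro!: l2_eqI)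

lemma inner_spread:
  assumes "r < 3" "s < 3"
  shows "inner (spread r f) (spread s g) = (if r = s then inner f g else 0)"
proof (cases "r = s")
  case True
  have "(\<lambda>n. inner (l2_nth f n) (l2_nth g n)) sums inner f g"
    unfolding inner_l2seq_def
    by (rule summable_sums[OF sqsum_summable_inner[OF sqsum_l2_nth sqsum_l2_nth]])
  then have "(\<lambda>n. if n mod 3 = s then inner (l2_nth f (n div 3)) (l2_nth g (n div 3)) else 0)
      sums inner f g"
    by (subst sums_spread[OF assms(2)])
  also have "(\<lambda>n. if n mod 3 = s then inner (l2_nth f (n div 3)) (l2_nth g (n div 3)) else 0)
      = (\<lambda>n. inner (l2_nth (spread r f) n) (l2_nth (spread s g) n))"
    using True assms by (auto simp: l2_nth_spread)
  finally show ?thesis using True by (simp add: inner_l2seq_def sums_iff)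
next
  case False
  then have "inner (l2_nth (spread r f) n) (l2_nth (spread s g) n) = 0" for n
    using assms by (auto simp: l2_nth_spread)
  then show ?thesis using False by (simp add: inner_l2seq_def)
qed

lemma cisometry_spread: "r < 3 \<Longrightarrow> cisometry (spread r)"
  by (rule cisometryI) (simp_all add: clinear_spread inner_spread)

section \<open>Commuting isometric dilations of commuting contractions\<close>

text \<open>
  Let \<open>P\<^sub>n\<close> be the alternating word \<open>\<dots>T T\<^sup>* T\<close> of length \<open>n\<close>.  The vectors \<open>d\<^sub>n = P\<^sub>nh - P\<^sub>n\<^sub>+\<^sub>2h\<close> satisfy
  \<open>\<parallel>d\<^sub>n\<parallel>\<^sup>2 = u\<^sub>n - u\<^sub>n\<^sub>+\<^sub>1\<close> with \<open>u\<^sub>n = \<parallel>P\<^sub>nh\<parallel>\<^sup>2 - \<parallel>P\<^sub>n\<^sub>+\<^sub>1h\<parallel>\<^sup>2\<close>, because \<open>P\<^sub>n\<^sub>+\<^sub>2 = X\<^sup>*XP\<^sub>n\<close> for \<open>X = T\<close> or \<open>X = T\<^sup>*\<close>.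
  As \<open>\<parallel>P\<^sub>nh\<parallel>\<close> decreases, \<open>u\<^sub>n\<close> tends to \<open>0\<close> and the series telescopes to \<open>u\<^sub>0 = \<parallel>h\<parallel>\<^sup>2 - \<parallel>Th\<parallel>\<^sup>2\<close>.  In terms of
  \<open>A = T\<^sup>*T\<close> this is the strongly convergent expansion \<open>1 - A = \<Sum>A\<^sup>n(1 - A)\<^sup>2\<close>.
\<close>

lemma defect_operator_exists:
  fixes T :: "'a::chilbert_space \<Rightarrow> 'a"
  assumes T: "contraction UNIV T"
  shows "\<exists>D :: 'a \<Rightarrow> 'a l2seq. clinear_on UNIV D \<and>
    (\<forall>h k. inner (D h) (D k) = inner h k - inner (T h) (T k))"
proof -
  obtain T' where T': "contraction UNIV T'" and adj: "inner (T x) y = inner x (T' y)" for x y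
    using contraction_adjoint[OF T] by metis
  define P :: "nat \<Rightarrow> 'a \<Rightarrow> 'a" where "P = rec_nat id (\<lambda>n p. (if even n then T else T') \<circ> p)"
  have P0: "P 0 h = h" and PS: "P (Suc n) h = (if even n then T else T') (P n h)" for n h
    by (simp_all add: P_def)
  have Pc: "clinear_on UNIV (P n)" for n
  proof (induction n)
    case (Suc n)
    then show ?case using T T' by (auto simp: clinear_on_def contraction_def PS)
  qed (simp add: clinear_on_def P0)
  define t where "t h n = (norm (P n h))\<^sup>2" for h n
  have two: "inner (P n h) (P (Suc (Suc n)) h) = t h (Suc n)" for n h
  proof (cases "even n")
    case True
    then show ?thesis by (simp add: PS t_def adj[symmetric] power2_norm_eq_inner)
  next
    case False
    then have "inner (P n h) (P (Suc (Suc n)) h) = inner (T (T' (P n h))) (P n h)"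
      by (simp add: PS inner_commute)
    then show ?thesis using False by (simp add: PS t_def adj power2_norm_eq_inner)
  qed
  have "decseq (t h)" for h
    using T T' by (intro decseq_SucI) (auto simp: t_def PS contraction_def)
  moreover have "\<forall>i. 0 \<le> t h i" for h by (simp add: t_def)
  ultimately have "\<exists>l. t h \<longlonglongrightarrow> l" for h by (metis decseq_convergent)
  then obtain l where l: "t h \<longlonglongrightarrow> l h" for h by metis
  define u where "u h n = t h n - t h (Suc n)" for h n
  have u0: "u h \<longlonglongrightarrow> 0" for h
    using tendsto_diff[OF l LIMSEQ_Suc[OF l], of h h] by (simp add: u_def[abs_def])
  define d where "d h n = P n h - P (Suc (Suc n)) h" for h n
  have nd: "(norm (d h n))\<^sup>2 = u h n - u h (Suc n)" for h n
    using two[of n h]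
    by (simp add: d_def u_def t_def power2_norm_eq_inner inner_diff_left inner_diff_right inner_commute)
  have sums: "(\<lambda>n. (norm (d h n))\<^sup>2) sums (u h 0)" for h
    unfolding nd using telescope_sums'[OF u0, of h] by simp
  define D where "D h = Abs_l2seq (d h)" for h
  have D: "l2_nth (D h) n = d h n" for h n
    using sums[of h] by (simp add: D_def Abs_l2seq_inverse sqsum_def sums_iff)
  have lin: "clinear_on UNIV D"
    using Pc unfolding clinear_on_def
    by (auto simp: l2_nth_inject[symmetric] fun_eq_iff D plus_l2seq.rep_eq scaleC_l2seq.rep_eq d_def
        scaleC_diff_right algebra_simps)
  have nD: "(norm (D h))\<^sup>2 = (norm h)\<^sup>2 - (norm (T h))\<^sup>2" for h
    using sums_unique[OF sums[of h]] by (simp add: norm_l2seq_sq D u_def t_def P0 PS)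
  have "inner (D h) (D k) = inner h k - inner (T h) (T k)" for h k
    using nD[of h] nD[of k] nD[of "h + k"] 
    by (simp add: inner_via_norm linear_add[OF clinear_linear[OF lin]]
       linear_add[OF contraction_linear[OF T]] field_simps)
  with lin show ?thesis by blast
qed

text \<open>
  The reflection \<open>R\<close> fixes the closed span of the vectors \<open>Q\<^sup>n(a h + b h)\<close> and is \<open>-1\<close> on its orthogonal
  complement \<open>N\<close>.  The Gram condition puts \<open>a h - b h\<close> into \<open>N\<close>, so \<open>R\<close> exchanges \<open>a h\<close> and \<open>b h\<close>.  The
  isometry \<open>Q\<close> maps the span into itself by construction, and it maps \<open>N\<close> into itself because the ranges
  of \<open>a\<close> and \<open>b\<close> are orthogonal to that of \<open>Q\<close>; hence \<open>R\<close> and \<open>Q\<close> commute.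
\<close>

lemma reflection_exists:
  fixes Q :: "'a::chilbert_space \<Rightarrow> 'a" and a b :: "'b::chilbert_space \<Rightarrow> 'a"
  assumes Q: "cisometry Q" and a: "clinear_on UNIV a" and b: "clinear_on UNIV b"
    and gram: "\<And>h k. inner (a h) (a k) = inner (b h) (b k)"
    and ab: "\<And>h k. inner (a h) (b k) = 0"
    and aQ: "\<And>h x. inner (a h) (Q x) = 0" and bQ: "\<And>h x. inner (b h) (Q x) = 0"
  shows "\<exists>R. cisometry R \<and> (\<forall>x. R (R x) = x) \<and> (\<forall>h. R (a h) = b h) \<and> (\<forall>x. R (Q x) = Q (R x))"
proof -
  define g where "g n h = (Q ^^ n) (a h + b h)" for n h
  have g0: "g 0 h = a h + b h" and gS: "g (Suc n) h = Q (g n h)" for n h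
    by (simp_all add: g_def)
  have g: "clinear_on UNIV (g n)" for n
    unfolding g_def[abs_def] using cisometry_funpow[OF Q, of n]
    by (intro clinear_comp[OF _ clinear_add[OF a b]]) (simp add: cisometry_def)
  define N where "N = {x. \<forall>n h. inner x (g n h) = 0}"
  have N_sub: "subspace N"
    by (auto simp: N_def subspace_def inner_add_left)
  have N_C: "c *\<^sub>C x \<in> N" if "x \<in> N" for c x
    using that by (simp add: N_def inner_scaleC_left clinear_scaleC[OF g, symmetric])
  have "N = (\<Inter>n. \<Inter>h. {x. inner x (g n h) = 0})" by (auto simp: N_def)
  then have "closed N" by (auto intro!: closed_INT closed_Collect_eq continuous_intros)
  then have "\<exists>p\<in>N. \<forall>s\<in>N. inner (x - p) s = 0" for x
    using orthogonal_projection_exists[OF N_sub] by blast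
  then obtain P where PN: "P x \<in> N" and perp: "s \<in> N \<Longrightarrow> inner (x - P x) s = 0" for x s
    by metis
  have P_eq: "P x = y" if y: "y \<in> N" "\<And>s. s \<in> N \<Longrightarrow> inner (x - y) s = 0" for x y
  proof -
    have "P x - y \<in> N" using PN y(1) N_sub by (simp add: subspace_diff)
    then have "inner (P x - y) (P x - y) = 0"
      using y(2)[of "P x - y"] perp[of "P x - y" x] by (simp add: inner_diff_left)
    then show ?thesis by simp
  qed
  have P_add: "P (x + y) = P x + P y" for x y
    using perp[of _ x] perp[of _ y]
    by (intro P_eq subspace_add[OF N_sub] PN) (simp add: inner_diff_left inner_add_left)
  have P_C: "P (c *\<^sub>C x) = c *\<^sub>C P x" for c x
    by (intro P_eq N_C PN) (simp add: scaleC_diff_right[symmetric] inner_scaleC_left perp N_C)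
  have PP: "P (P x) = P x" for x by (rule P_eq) (simp_all add: PN)
  define R where "R x = x - (P x + P x)" for x
  have R_lin: "clinear_on UNIV R"
    by (simp add: clinear_on_def R_def P_add P_C scaleC_diff_right scaleC_add_right algebra_simps)
  have "cisometry R"
  proof (rule cisometryI[OF R_lin])
    fix x
    show "inner (R x) (R x) = inner x x" using perp[OF PN, of x x]
      by (simp add: R_def inner_diff_left inner_diff_right inner_add_left inner_add_right inner_commute)
  qed
  moreover have "R (R x) = x" for x
  proof -
    have "P (R x) + (P x + P x) = P x" using P_add[of "R x" "P x + P x"] by (simp add: R_def P_add PP)
    then have "P (R x) = - P x" by (simp add: algebra_simps eq_neg_iff_add_eq_0)
    then show ?thesis by (simp add: R_def[of "R x"]) (simp add: R_def)
  qed
  moreover have "R (a h) = b h" for h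
  proof -
    have "a h - b h \<in> N"
    proof -
      have "inner (a h - b h) (g n k) = 0" for n k
        by (cases n) (simp_all add: g0 gS inner_diff_left inner_add_right ab aQ bQ gram
            inner_commute[of "b h" "a k"])
      then show ?thesis by (simp add: N_def)
    qed
    then have "P (a h) = (1/2) *\<^sub>R (a h - b h)"
    proof (intro P_eq)
      fix s assume s: "s \<in> N"
      have "a h - (1/2) *\<^sub>R (a h - b h) = (1/2) *\<^sub>R g 0 h"
      proof -
        have "2 *\<^sub>R (a h - (1/2) *\<^sub>R (a h - b h)) = 2 *\<^sub>R ((1/2) *\<^sub>R g 0 h)"
          by (simp add: g0 scaleR_diff_right scaleR_2)
        then show ?thesis by (simp only: scaleR_cancel_left) simp
      qed
      then show "inner (a h - (1/2) *\<^sub>R (a h - b h)) s = 0"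
        using s by (simp add: N_def inner_commute)
    qed (simp add: subspace_scale[OF N_sub])
    then show ?thesis by (simp add: R_def scaleR_add_left[symmetric])
  qed
  moreover have "R (Q x) = Q (R x)" for x
  proof -
    obtain Q' where Q': "inner (Q x) y = inner x (Q' y)" for x y
      using adjoint_exists[OF cisometry_bounded_linear[OF Q]] by metis
    \<comment> \<open>The adjoint of \<open>Q\<close> preserves \<open>N\<close>, hence \<open>Q\<close> preserves the orthogonal complement of \<open>N\<close>.\<close>
    have "P (Q x) = Q (P x)"
    proof (rule P_eq)
      have "inner (Q (P x)) (g n h) = 0" for n h
        using PN[of x]
        by (cases n) (simp_all add: g0 gS inner_add_right aQ bQ cisometry_inner[OF Q] N_def
            inner_commute[of "Q (P x)" "a h"] inner_commute[of "Q (P x)" "b h"])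
      then show "Q (P x) \<in> N" by (simp add: N_def)
      fix s assume s: "s \<in> N"
      then have "Q' s \<in> N"
        by (simp add: N_def inner_commute[of "Q' s"] Q'[symmetric] gS[symmetric]) (simp add: inner_commute)
      then show "inner (Q x - Q (P x)) s = 0"
        by (simp add: linear_diff[OF cisometry_linear[OF Q], symmetric] Q' perp)
    qed
    then show ?thesis
      by (simp add: R_def linear_diff[OF cisometry_linear[OF Q]] linear_add[OF cisometry_linear[OF Q]])
  qed
  ultimately show ?thesis by blast
qed

text \<open>
  With defect maps \<open>d\<^sub>i\<close> and a shift \<open>s\<close> having mutually orthogonal ranges, \<open>W\<^sub>i(h, g) = (T\<^sub>ih, d\<^sub>ih + s g)\<close>
  is an isometry.  The products \<open>W\<^sub>1W\<^sub>2\<close> and \<open>W\<^sub>2W\<^sub>1\<close> agree except that \<open>h\<close> contributes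
  \<open>a h = d\<^sub>1T\<^sub>2h + s d\<^sub>2h\<close> to the former and \<open>b h = d\<^sub>2T\<^sub>1h + s d\<^sub>1h\<close> to the latter.  Both have norm square
  \<open>\<parallel>h\<parallel>\<^sup>2 - \<parallel>T\<^sub>1T\<^sub>2h\<parallel>\<^sup>2\<close>.  If the involution \<open>R\<close> takes \<open>a h\<close> to \<open>b h\<close>
  and commutes with \<open>s\<^sup>2\<close>, then \<open>V\<^sub>1 = R W\<^sub>1\<close> and \<open>V\<^sub>2 = W\<^sub>2R\<close> commute, \<open>R\<close> acting on the second component.
\<close>

theorem ando_isometric_dilation:
  fixes T1 T2 :: "'a::chilbert_space \<Rightarrow> 'a"
  assumes T: "contraction UNIV T1" "contraction UNIV T2"
    and comm: "\<And>h. T1 (T2 h) = T2 (T1 h)"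
  shows "\<exists>V1 V2 :: 'a l2seq \<Rightarrow> 'a l2seq. cisometry V1 \<and> cisometry V2 \<and>
    (\<forall>f. V1 (V2 f) = V2 (V1 f)) \<and>
    (\<forall>f. l2_hd (V1 f) = T1 (l2_hd f)) \<and> (\<forall>f. l2_hd (V2 f) = T2 (l2_hd f))"
proof -
  obtain D1 :: "'a \<Rightarrow> 'a l2seq" where D1: "clinear_on UNIV D1"
    "\<And>h k. inner (D1 h) (D1 k) = inner h k - inner (T1 h) (T1 k)"
    using defect_operator_exists[OF T(1)] by metis
  obtain D2 :: "'a \<Rightarrow> 'a l2seq" where D2: "clinear_on UNIV D2"
    "\<And>h k. inner (D2 h) (D2 k) = inner h k - inner (T2 h) (T2 k)"
    using defect_operator_exists[OF T(2)] by metis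
  have lT: "clinear_on UNIV T1" "clinear_on UNIV T2" using T by (simp_all add: contraction_def)
  define d1 where "d1 h = spread 0 (D1 h)" for h
  define d2 where "d2 h = spread 1 (D2 h)" for h
  define s where "s = (spread 2 :: 'a l2seq \<Rightarrow> 'a l2seq)"
  note defs = d1_def d2_def s_def
  have lin: "clinear_on UNIV d1" "clinear_on UNIV d2" "clinear_on UNIV s"
    unfolding defs[abs_def]
    by (intro clinear_comp[OF clinear_spread D1(1)] clinear_comp[OF clinear_spread D2(1)]
        clinear_spread; simp)+
  note inn = inner_add_left inner_add_right inner_spread D1(2) D2(2) comm
  define a where "a h = d1 (T2 h) + s (d2 h)" for h
  define b where "b h = d2 (T1 h) + s (d1 h)" for h
  have s: "cisometry s" by (simp add: s_def cisometry_spread)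
  have "\<exists>R. cisometry R \<and> (\<forall>x. R (R x) = x) \<and> (\<forall>h. R (a h) = b h) \<and>
      (\<forall>x. R ((s \<circ> s) x) = (s \<circ> s) (R x))"
  proof (rule reflection_exists)
    show "cisometry (s \<circ> s)" by (intro cisometry_comp s)
    show "clinear_on UNIV a" "clinear_on UNIV b"
      unfolding a_def[abs_def] b_def[abs_def]
      by (intro clinear_add clinear_comp[OF lin(1) lT(2)] clinear_comp[OF lin(3)]
          clinear_comp[OF lin(2) lT(1)] lin)+
  qed (simp_all add: a_def b_def defs inn)
  then obtain R where R: "cisometry R" "\<And>x. R (R x) = x" "\<And>h. R (a h) = b h"
    "\<And>x. R (s (s x)) = s (s (R x))" by auto
  note linR = cisometry_linear[OF R(1)] and lins = cisometry_linear[OF s]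
  have cR: "clinear_on UNIV R" using R(1) by (simp add: cisometry_def)
  define V1 where "V1 f = l2_cons (T1 (l2_hd f)) (R (d1 (l2_hd f) + s (l2_tl f)))" for f
  define V2 where "V2 f = l2_cons (T2 (l2_hd f)) (d2 (l2_hd f) + s (R (l2_tl f)))" for f
  note hd = clinear_l2_hd[where 'a = 'a] and tl = clinear_l2_tl[where 'a = 'a]
  have cons: "clinear_on UNIV (\<lambda>f. l2_cons (p f) (q f))"
    if "clinear_on UNIV p" "clinear_on UNIV q" for p :: "'a l2seq \<Rightarrow> 'a" and q
    using that by (simp add: clinear_on_def l2_cons_add l2_cons_scaleC)
  have "cisometry V1"
  proof (rule cisometryI)
    show "clinear_on UNIV V1" unfolding V1_def[abs_def]
      by (intro cons clinear_comp[OF lT(1)] clinear_comp[OF cR] clinear_add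
          clinear_comp[OF lin(1)] clinear_comp[OF lin(3)] hd tl)
    show "inner (V1 f) (V1 f) = inner f f" for f
      by (subst inner_hd_tl[of f f])
        (simp add: V1_def inner_cons cisometry_inner[OF R(1)] defs inn)
  qed
  moreover have "cisometry V2"
  proof (rule cisometryI)
    show "clinear_on UNIV V2" unfolding V2_def[abs_def]
      by (intro cons clinear_comp[OF lT(2)] clinear_comp[OF cR] clinear_add
          clinear_comp[OF lin(2)] clinear_comp[OF lin(3)] hd tl)
    show "inner (V2 f) (V2 f) = inner f f" for f
      by (subst inner_hd_tl[of f f])
        (simp add: V2_def inner_cons cisometry_inner[OF R(1)] defs inn)
  qed
  moreover have "V1 (V2 f) = V2 (V1 f)" for f
  proof -
    let ?h = "l2_hd f" and ?g = "l2_tl f"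
    have "R (d1 (T2 ?h) + s (d2 ?h + s (R ?g))) = R (a ?h + s (s (R ?g)))"
      by (simp add: a_def linear_add[OF lins] add.assoc)
    also have "\<dots> = b ?h + s (s ?g)" by (simp add: linear_add[OF linR] R)
    also have "\<dots> = d2 (T1 ?h) + s (R (R (d1 ?h + s ?g)))"
      by (simp add: b_def R linear_add[OF lins])
    finally show ?thesis by (simp add: V1_def V2_def comm)
  qed
  moreover have "l2_hd (V1 f) = T1 (l2_hd f)" "l2_hd (V2 f) = T2 (l2_hd f)" for f
    by (simp_all add: V1_def V2_def)
  ultimately show ?thesis by blast
qed

section \<open>Unitary extension\<close>

text \<open>
  The inverse \<open>W\<close> is a parameter because outside \<open>L\<close> nothing is required of the operators, so
  neither the inverse function of \<open>U\<close> nor its adjoint on the whole type is the right one.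
\<close>

definition unitary_on :: "'a::chilbert_space set \<Rightarrow> ('a \<Rightarrow> 'a) \<Rightarrow> ('a \<Rightarrow> 'a) \<Rightarrow> bool" where
  "unitary_on L U W \<longleftrightarrow> U ` L \<subseteq> L \<and> W ` L \<subseteq> L \<and> clinear_on L U \<and>
     (\<forall>x\<in>L. norm (U x) = norm x \<and> W (U x) = x \<and> U (W x) = x)"

lemma cisometry_closed_csubspace_range:
  assumes V: "cisometry V"
  shows "closed_csubspace (range V)"
proof -
  have "complete (range V)"
    by (rule complete_isometric_image[of 1 UNIV])
       (use cisometry_bounded_linear[OF V] V in \<open>auto simp: cisometry_def complete_UNIV\<close>)
  moreover have "V x + V y = V (x + y)" "c *\<^sub>C V x = V (c *\<^sub>C x)" "0 = V 0" for x y c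
    using V linear_0[OF cisometry_linear[OF V]] by (simp_all add: cisometry_def clinear_on_def)
  ultimately show ?thesis unfolding closed_csubspace_def by (blast intro: complete_imp_closed)
qed

lemma closed_csubspace_INT:
  "(\<And>i. closed_csubspace (L i)) \<Longrightarrow> closed_csubspace (\<Inter>i. L i)"
  unfolding closed_csubspace_def by (auto intro!: closed_INT)

lemma unitary_on_inverse_of_isometry:
  assumes X: "cisometry X" and L: "closed_csubspace L" and XL: "X ` L = L"
  shows "unitary_on L (inv X) X"
proof -
  have inv1: "inv X (X x) = x" for x using cisometry_inj[OF X] by simp
  have cl: "X x + X y = X (x + y)" "c *\<^sub>C X x = X (c *\<^sub>C x)" "norm (X x) = norm x" for x y c
    using X by (simp_all add: cisometry_def clinear_on_def)
  have "\<exists>y\<in>L. x = X y" if "x \<in> L" for x using XL that by blast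
  then have lift: "x \<in> L \<Longrightarrow> inv X x \<in> L \<and> X (inv X x) = x" for x using inv1 by metis
  have "inv X x + inv X y = inv X (x + y)" if "x \<in> L" "y \<in> L" for x y
    using lift[OF that(1)] lift[OF that(2)] cl(1)[of "inv X x" "inv X y"] inv1 by metis
  moreover have "c *\<^sub>C inv X x = inv X (c *\<^sub>C x)" if "x \<in> L" for c x
    using lift[OF that] cl(2)[of c "inv X x"] inv1 by metis
  ultimately have "clinear_on L (inv X)" by (simp add: clinear_on_def)
  moreover have "norm (inv X x) = norm x" if "x \<in> L" for x
    using lift[OF that] cl(3)[of "inv X x"] by simp
  ultimately show ?thesis unfolding unitary_on_def using lift XL inv1 by blast
qed

text \<open>
  Let \<open>X\<^sub>1\<close>, \<open>X\<^sub>2\<close> be the commuting isometries that dilate the commuting contractions \<open>V\<^sub>1\<^sup>*\<close>, \<open>V\<^sub>2\<^sup>*\<close>.  On the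
  intersection \<open>L\<close> of the ranges of the powers of \<open>W = X\<^sub>1X\<^sub>2\<close>, the isometry \<open>W\<close> is onto, hence so are its
  commuting factors \<open>X\<^sub>1\<close> and \<open>X\<^sub>2\<close>, and their inverses on \<open>L\<close> are unitary.  The equality \<open>X\<^sub>i(V\<^sub>ik, 0) = (k, 0)\<close>
  shows both that \<open>L\<close> contains all \<open>(k, 0)\<close> and that the inverse of \<open>X\<^sub>i\<close> extends \<open>V\<^sub>i\<close>.
\<close>

theorem commuting_isometries_unitary_extension:
  fixes V1 V2 :: "'b::chilbert_space \<Rightarrow> 'b"
  assumes V: "cisometry V1" "cisometry V2" and comm: "\<And>x. V1 (V2 x) = V2 (V1 x)"
  shows "\<exists>(L :: 'b l2seq set) U1 U2 W1 W2. closed_csubspace L \<and>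
    unitary_on L U1 W1 \<and> unitary_on L U2 W2 \<and> (\<forall>x\<in>L. U1 (U2 x) = U2 (U1 x)) \<and>
    (\<forall>k. l2_cons k 0 \<in> L \<and> U1 (l2_cons k 0) = l2_cons (V1 k) 0 \<and> U2 (l2_cons k 0) = l2_cons (V2 k) 0)"
proof -
  have con: "contraction UNIV V1" "contraction UNIV V2"
    using V by (auto simp: contraction_def cisometry_def)
  obtain A1 where A1: "contraction UNIV A1" "\<And>x y. inner (V1 x) y = inner x (A1 y)"
    using contraction_adjoint[OF con(1)] by metis
  obtain A2 where A2: "contraction UNIV A2" "\<And>x y. inner (V2 x) y = inner x (A2 y)"
    using contraction_adjoint[OF con(2)] by metis
  have "A1 (A2 y) = A2 (A1 y)" for y
    by (rule inner_ext) (simp add: A1(2)[symmetric] A2(2)[symmetric] comm)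
  then obtain X1 X2 :: "'b l2seq \<Rightarrow> 'b l2seq" where X: "cisometry X1" "cisometry X2"
    and X_comm: "\<And>f. X1 (X2 f) = X2 (X1 f)"
    and hd: "\<And>f. l2_hd (X1 f) = A1 (l2_hd f)" "\<And>f. l2_hd (X2 f) = A2 (l2_hd f)"
    using ando_isometric_dilation[OF A1(1) A2(1)] by metis
  \<comment> \<open>Both sides have norm \<open>\<parallel>k\<parallel>\<close>, and their inner product is \<open>\<langle>V\<^sup>*Vk, k\<rangle> = \<parallel>k\<parallel>\<^sup>2\<close>,
    the equality case of the Cauchy--Schwarz inequality.\<close>
  have co: "X (l2_cons (V' k) 0) = l2_cons k 0"
    if "cisometry X" "cisometry V'" "\<And>x y. inner (V' x) y = inner x (A y)" "\<And>f. l2_hd (X f) = A (l2_hd f)"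
    for X :: "'b l2seq \<Rightarrow> 'b l2seq" and V' A k
  proof -
    let ?u = "X (l2_cons (V' k) 0)" and ?v = "l2_cons k 0"
    have "inner ?u ?v = inner k k"
      by (simp only: inner_cons_zero that(4) l2_hd_cons)
        (simp only: inner_commute[of "A _"] that(3)[symmetric] cisometry_inner[OF that(2)])
    moreover have "inner ?u ?u = inner k k" "inner ?v ?v = inner k k"
      by (simp_all add: cisometry_inner[OF that(1)] inner_cons cisometry_inner[OF that(2)])
    ultimately have "inner (?u - ?v) (?u - ?v) = 0"
      by (simp add: inner_diff_left inner_diff_right inner_commute)
    then show ?thesis by simp
  qed
  note co1 = co[OF X(1) V(1) A1(2) hd(1)] and co2 = co[OF X(2) V(2) A2(2) hd(2)]
  define W where "W = X1 \<circ> X2"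
  have W: "cisometry W" unfolding W_def by (intro cisometry_comp X)
  define L where "L = (\<Inter>n. range (W ^^ n))"
  have L: "closed_csubspace L" unfolding L_def
    by (intro closed_csubspace_INT cisometry_closed_csubspace_range cisometry_funpow W)
  have inv: "X x \<in> L" if x: "x \<in> L" and X: "\<And>y. X (W y) = W (X y)" for X x
  proof -
    have *: "X ((W ^^ n) y) = (W ^^ n) (X y)" for n y by (induction n) (simp_all add: X)
    have "X x \<in> range (W ^^ n)" for n
    proof -
      obtain y where "x = (W ^^ n) y" using x unfolding L_def by blast
      then show ?thesis using *[of n y] by simp
    qed
    then show ?thesis by (simp add: L_def)
  qed
  have inv1: "X1 x \<in> L" and inv2: "X2 x \<in> L" if "x \<in> L" for x
    by (rule inv[OF that], simp add: W_def X_comm)+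
  have W_onto: "\<exists>y\<in>L. x = W y" if x: "x \<in> L" for x
  proof -
    have "\<exists>y. x = W ((W ^^ n) y)" for n
    proof -
      obtain y where "x = (W ^^ Suc n) y" using x unfolding L_def by blast
      then show ?thesis by auto
    qed
    then obtain y where y: "x = W ((W ^^ n) (y n))" for n by metis
    \<comment> \<open>As \<open>W\<close> is injective, the preimage of \<open>x\<close> is the same vector for every \<open>n\<close>.\<close>
    have "(W ^^ n) (y n) = y 0" for n
      using injD[OF cisometry_inj[OF W], of "(W ^^ n) (y n)" "y 0"] y[of n] y[of 0] by simp
    then have "y 0 \<in> range (W ^^ n)" for n by (metis rangeI)
    then have "y 0 \<in> L" by (simp add: L_def)
    then show ?thesis using y[of 0] by auto
  qed
  have XL: "X1 ` L = L" "X2 ` L = L"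
  proof -
    have "x \<in> X1 ` L" "x \<in> X2 ` L" if x: "x \<in> L" for x
    proof -
      obtain y where y: "y \<in> L" "x = X1 (X2 y)" using W_onto[OF x] by (auto simp: W_def)
      then show "x \<in> X1 ` L" using inv2 by blast
      show "x \<in> X2 ` L" using y inv1 X_comm by blast
    qed
    then show "X1 ` L = L" "X2 ` L = L" using inv1 inv2 by blast+
  qed
  note U = unitary_on_inverse_of_isometry[OF X(1) L XL(1)] unitary_on_inverse_of_isometry[OF X(2) L XL(2)]
  have inv_inv: "inv X1 (X1 x) = x" "inv X2 (X2 x) = x" for x
    using X by (simp_all add: cisometry_inj)
  have "inv X1 (inv X2 x) = inv X2 (inv X1 x)" if "x \<in> L" for x
  proof -
    from W_onto[OF that] obtain y where "x = X1 (X2 y)" by (auto simp: W_def)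
    then show ?thesis by (metis X_comm inv_inv)
  qed
  moreover have "l2_cons k 0 \<in> L" for k
  proof -
    have step: "W (l2_cons (V2 (V1 k)) 0) = l2_cons k 0" for k
      by (simp add: W_def co1 co2)
    have "l2_cons k 0 = (W ^^ n) (l2_cons (((V2 \<circ> V1) ^^ n) k) 0)" for n
    proof (induction n)
      case (Suc n)
      have "(W ^^ Suc n) (l2_cons (((V2 \<circ> V1) ^^ Suc n) k) 0)
          = (W ^^ n) (W (l2_cons (V2 (V1 (((V2 \<circ> V1) ^^ n) k))) 0))"
        by (simp only: funpow.simps(2) comp_apply funpow_swap1[of W])
      then show ?case by (simp only: step Suc)
    qed simp
    then show ?thesis unfolding L_def by blast
  qed
  moreover have "inv X1 (l2_cons k 0) = l2_cons (V1 k) 0" "inv X2 (l2_cons k 0) = l2_cons (V2 k) 0" for k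
    using inv_inv co1 co2 by metis+
  ultimately show ?thesis using L U by blast
qed

lemma unitary_on_sym:
  assumes L: "closed_csubspace L" and U: "unitary_on L U W"
  shows "unitary_on L W U"
proof -
  have W: "W x \<in> L" "U (W x) = x" "W (U x) = x" "norm (U x) = norm x" if "x \<in> L" for x
    using U that by (auto simp: unitary_on_def)
  have lin: "U (x + y) = U x + U y" "U (c *\<^sub>C x) = c *\<^sub>C U x" if "x \<in> L" "y \<in> L" for x y c
    using U that by (simp_all add: unitary_on_def clinear_on_def)
  have L': "x + y \<in> L" "c *\<^sub>C x \<in> L" if "x \<in> L" "y \<in> L" for x y c
    using L that by (simp_all add: closed_csubspace_def)
  have "W (x + y) = W x + W y" if "x \<in> L" "y \<in> L" for x y
    using W(3)[OF L'(1)[OF W(1) W(1)], OF that] lin(1)[OF W(1) W(1), OF that] W(2) that by simp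
  moreover have "W (c *\<^sub>C x) = c *\<^sub>C W x" if "x \<in> L" for x c
    using W(3)[OF L'(2)[OF W(1) W(1)], OF that that] lin(2)[OF W(1) W(1), OF that that] W(2) that by simp
  moreover have "norm (W x) = norm x" if "x \<in> L" for x
    using W(4)[OF W(1)[OF that]] W(2)[OF that] by simp
  ultimately show ?thesis using U by (simp add: unitary_on_def clinear_on_def)
qed

lemma unitary_on_comp:
  assumes "unitary_on L U W" "unitary_on L U' W'"
  shows "unitary_on L (U \<circ> U') (W' \<circ> W)"
proof -
  have "U x \<in> L" "W x \<in> L" "U' x \<in> L" "W' x \<in> L" if "x \<in> L" for x
    using assms that by (auto simp: unitary_on_def)
  then show ?thesis using assms by (auto simp: unitary_on_def clinear_on_def)
qed

lemma unitary_on_inner: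
  assumes U: "unitary_on L U W" and L: "closed_csubspace L" and xy: "x \<in> L" "y \<in> L"
  shows "inner (U x) (U y) = inner x y"
proof -
  have "U x + U y = U (x + y)" using U xy by (simp add: unitary_on_def clinear_on_def)
  moreover have "x + y \<in> L" using L xy by (simp add: closed_csubspace_def)
  ultimately show ?thesis using U xy by (simp add: inner_via_norm unitary_on_def)
qed

lemma unitary_on_normal:
  assumes U: "unitary_on L U W" and L: "closed_csubspace L"
  shows "normal_op L U"
proof -
  have lin: "clinear_on L U" using U by (simp add: unitary_on_def)
  have *: "U x \<in> L" "W x \<in> L" "U (W x) = x" "W (U x) = x" if "x \<in> L" for x
    using U that by (auto simp: unitary_on_def)
  have "adj_on L U y = W y" if y: "y \<in> L" for y
  proof (rule adj_on_eqI[OF L lin *(2)[OF y]])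
    fix x assume x: "x \<in> L"
    show "inner (U x) y = inner x (W y)"
      using unitary_on_inner[OF U L x *(2)[OF y]] *(3)[OF y] by simp
  qed
  then have "commuting_on L U (adj_on L U)" using * by (simp add: commuting_on_def)
  moreover have "bounded_op L U"
    unfolding bounded_op_def using U by (auto simp: unitary_on_def intro!: exI[of _ 1])
  ultimately show ?thesis by (simp add: normal_op_def)
qed

text \<open>
  The spectrum of a unitary lies on the unit circle.  Solving \<open>Uv - cv = w\<close> is a fixed point problem:
  \<open>v = U\<^sup>-\<^sup>1(w + cv)\<close> is a contraction in \<open>v\<close> for \<open>\<bar>c\<bar> < 1\<close>, and \<open>v = (Uv - w)/c\<close> is one for \<open>\<bar>c\<bar> > 1\<close>.
\<close>

lemma unitary_on_minus_scalar_bij: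
  assumes U: "unitary_on L U W" and L: "closed_csubspace L" and c: "norm c \<noteq> 1"
  shows "bij_betw (\<lambda>v. U v - c *\<^sub>C v) L L"
proof -
  have W: "unitary_on L W U" by (rule unitary_on_sym[OF L U])
  have *: "U x \<in> L" "W x \<in> L" "U (W x) = x" "W (U x) = x" "norm (U x) = norm x" "norm (W x) = norm x"
    if "x \<in> L" for x
    using U W that by (auto simp: unitary_on_def)
  have LC: "a *\<^sub>C x \<in> L" if "x \<in> L" for a x
    using L that by (simp add: closed_csubspace_def)
  have Ladd: "x + y \<in> L" and Ldiff: "x - y \<in> L" if "x \<in> L" "y \<in> L" for x y
    using L that closed_csubspace_diff[OF L that] by (simp_all add: closed_csubspace_def)
  have diff: "F (x - y) = F x - F y" if "clinear_on L F" "x \<in> L" "y \<in> L" for F :: "'a \<Rightarrow> 'a" and x y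
  proof -
    have "F (x - y + y) = F (x - y) + F y" using that Ldiff[OF that(2,3)] unfolding clinear_on_def by blast
    then show ?thesis by simp
  qed
  have lin: "clinear_on L U" "clinear_on L W" using U W by (simp_all add: unitary_on_def)
  have complete: "complete L" using L by (simp add: closed_csubspace_def complete_eq_closed)
  have ne: "L \<noteq> {}" using L by (auto simp: closed_csubspace_def)
  have "inj_on (\<lambda>v. U v - c *\<^sub>C v) L"
  proof (rule inj_onI)
    fix v w assume vw: "v \<in> L" "w \<in> L" "U v - c *\<^sub>C v = U w - c *\<^sub>C w"
    then have "U (v - w) = c *\<^sub>C (v - w)" by (simp add: diff[OF lin(1)] scaleC_diff_right algebra_simps)
    then have "norm (v - w) = norm c * norm (v - w)"
      using *(5)[OF Ldiff[OF vw(1,2)]] by (simp add: norm_scaleC)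
    then show "v = w" using c by simp
  qed
  moreover have "\<exists>v\<in>L. w = U v - c *\<^sub>C v" if w: "w \<in> L" for w
  proof (cases "norm c < 1")
    case True
    let ?f = "\<lambda>v. W (w + c *\<^sub>C v)"
    have "\<exists>!v\<in>L. ?f v = v"
    proof (rule Banach_fix[OF complete ne _ True])
      show "?f ` L \<subseteq> L" by (intro image_subsetI *(1,2) LC Ldiff Ladd w)
      fix x y assume xy: "x \<in> L" "y \<in> L"
      have "?f x - ?f y = W ((w + c *\<^sub>C x) - (w + c *\<^sub>C y))" using Ladd LC w xy by (simp only: diff[OF lin(2)])
      also have "(w + c *\<^sub>C x) - (w + c *\<^sub>C y) = c *\<^sub>C (x - y)" by (simp add: scaleC_diff_right)
      finally show "dist (?f x) (?f y) \<le> norm c * dist x y"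
        using *(6)[OF LC[OF Ldiff[OF xy]], of c] by (simp add: dist_norm norm_scaleC)
    qed simp
    then obtain v where v: "v \<in> L" "?f v = v" by blast
    have "U v = w + c *\<^sub>C v" using *(3)[OF Ladd[OF w LC[OF v(1)]], of c] v(2) by simp
    then show ?thesis using v(1) by (intro bexI[of _ v]) simp_all
  next
    case False
    then have c1: "norm c > 1" using c by simp
    then have c0: "c \<noteq> 0" by auto
    let ?f = "\<lambda>v. (1 / c) *\<^sub>C (U v - w)"
    have "\<exists>!v\<in>L. ?f v = v"
    proof (rule Banach_fix[OF complete ne, of "1 / norm c"])
      show "?f ` L \<subseteq> L" by (intro image_subsetI *(1,2) LC Ldiff Ladd w)
      fix x y assume xy: "x \<in> L" "y \<in> L"
      have "?f x - ?f y = (1 / c) *\<^sub>C U (x - y)"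
        by (simp add: diff[OF lin(1) xy] scaleC_diff_right[symmetric])
      then show "dist (?f x) (?f y) \<le> 1 / norm c * dist x y"
        using *(5)[OF Ldiff[OF xy]] by (simp add: dist_norm norm_scaleC norm_divide)
    qed (use c0 c1 in simp_all)
    then obtain v where v: "v \<in> L" "?f v = v" by blast
    have "c *\<^sub>C v = c *\<^sub>C ?f v" using v(2) by simp
    also have "\<dots> = U v - w"
      using c0 by (simp add: scaleC_scaleC scaleC_one)
    finally show ?thesis using v(1) by (intro bexI[of _ v]) simp_all
  qed
  moreover have "U v - c *\<^sub>C v \<in> L" if "v \<in> L" for v
    by (intro Ldiff LC *(1) that)
  ultimately show ?thesis unfolding bij_betw_def by blast
qed

section \<open>Taylor spectrum of commuting tuples\<close>

locale commuting_tuple =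
  fixes S :: "'a::chilbert_space set" and Ts :: "('a \<Rightarrow> 'a) list"
  assumes S: "closed_csubspace S"
    and T_image: "T \<in> set Ts \<Longrightarrow> T ` S \<subseteq> S"
    and T_clinear: "T \<in> set Ts \<Longrightarrow> clinear_on S T"
    and T_commute: "T \<in> set Ts \<Longrightarrow> T' \<in> set Ts \<Longrightarrow> commuting_on S T T'"
begin

lemma T_mem: "i < length Ts \<Longrightarrow> x \<in> S \<Longrightarrow> (Ts ! i) x \<in> S"
  using T_image[OF nth_mem] by blast

lemma T_clinear_nth: "i < length Ts \<Longrightarrow> clinear_on S (Ts ! i)"
  by (rule T_clinear[OF nth_mem])

lemma T_commute_nth: "i < length Ts \<Longrightarrow> j < length Ts \<Longrightarrow> x \<in> S \<Longrightarrow>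
    (Ts ! i) ((Ts ! j) x) = (Ts ! j) ((Ts ! i) x)"
  using T_commute[OF nth_mem nth_mem] by (simp add: commuting_on_def)

lemma S0: "0 \<in> S" and Sadd: "x \<in> S \<Longrightarrow> y \<in> S \<Longrightarrow> x + y \<in> S"
  and SC: "x \<in> S \<Longrightarrow> c *\<^sub>C x \<in> S"
  using S by (auto simp: closed_csubspace_def)

text \<open>
  The homotopy dual to the Koszul differential contracts the complex: with \<open>D\<^sub>i = T\<^sub>i - x\<^sub>i\<close> put
  \<open>g A = \<Sum>\<plusminus>B\<^sub>k f(A \<union> {k})\<close>, the sum over \<open>k\<close> outside \<open>A\<close>.  In the differential of \<open>g\<close> at \<open>A\<close>, putting back
  the removed index gives \<open>D\<^sub>iB\<^sub>i f A\<close> for \<open>i \<in> A\<close>; the mixed terms add up, because \<open>f\<close> is a cycle at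
  \<open>A \<union> {k}\<close>, to \<open>D\<^sub>kB\<^sub>k f A\<close> for \<open>k \<notin> A\<close>.  The total is \<open>\<Sum>D\<^sub>iB\<^sub>i f A = f A\<close>.
\<close>

lemma koszul_exact_of_bezout:
  assumes BS: "\<And>i x. i < length Ts \<Longrightarrow> x \<in> S \<Longrightarrow> B i x \<in> S"
    and Blin: "\<And>i. i < length Ts \<Longrightarrow> clinear_on S (B i)"
    and comm: "\<And>i j x. i < length Ts \<Longrightarrow> j < length Ts \<Longrightarrow> x \<in> S \<Longrightarrow> B i ((Ts ! j) x) = (Ts ! j) (B i x)"
    and unit: "\<And>x. x \<in> S \<Longrightarrow> (\<Sum>i<length Ts. (Ts ! i) (B i x) - xs ! i *\<^sub>C B i x) = x"
  shows "koszul_exact S Ts xs"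
  unfolding koszul_exact_def
proof (intro ballI impI)
  let ?n = "length Ts"
  fix f assume f: "f \<in> Pow {..<?n} \<rightarrow> S" and ker: "\<forall>A\<subseteq>{..<?n}. koszul_diff Ts xs f A = 0"
  define D where "D i v = (Ts ! i) v - xs ! i *\<^sub>C v" for i v
  define e :: "nat \<Rightarrow> nat set \<Rightarrow> real" where "e i A = (-1) ^ card {j \<in> A. j < i}" for i A
  have diff: "koszul_diff Ts xs g A = (\<Sum>i\<in>A. e i A *\<^sub>R D i (g (A - {i})))" for g A
    by (simp add: koszul_diff_def D_def e_def)
  have e2: "e i A * e i A = 1" for i A
    by (simp add: e_def flip: power_add mult_2) 
  have e_same: "e i (A - {i}) = e i A" "e i (insert i A) = e i A" for i A
    by (auto simp: e_def intro!: arg_cong[where f = "\<lambda>X. (-1) ^ card X"])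
  have e_ins: "e i (insert k A) = (if k < i then - e i A else e i A)" if "k \<notin> A" "finite A" for i k A
  proof -
    have "{j \<in> insert k A. j < i} = (if k < i then insert k {j \<in> A. j < i} else {j \<in> A. j < i})"
      by auto
    then show ?thesis using that by (simp add: e_def)
  qed
  \<comment> \<open>The sign relation that identifies the mixed terms: of the two distinct indices \<open>i\<close> and \<open>k\<close>,
    exactly one is below the other.\<close>
  have e_swap: "e i A * e k (A - {i}) = - (e k A * e i (insert k A))"
    if "i \<in> A" "k \<notin> A" "finite A" for i k A
  proof -
    have ek: "e k A = (if i < k then - e k (A - {i}) else e k (A - {i}))"
      using e_ins[of i "A - {i}" k] that by (simp add: insert_absorb)
    have "i \<noteq> k" using that by blast
    then show ?thesis using that by (cases "i < k") (simp_all add: ek e_ins)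
  qed
  have SR: "r *\<^sub>R x \<in> S" if "x \<in> S" for r x using SC[OF that] by (simp add: scaleR_scaleC)
  have Sdiff: "x - y \<in> S" if "x \<in> S" "y \<in> S" for x y
    using Sadd[OF that(1) SR[OF that(2), of "-1"]] by simp
  have Ssum: "(\<Sum>i\<in>I. h i) \<in> S" if "\<And>i. i \<in> I \<Longrightarrow> h i \<in> S" for I and h :: "nat \<Rightarrow> 'a"
    using that by (induction I rule: infinite_finite_induct) (auto intro: S0 Sadd)
  have fS: "f A \<in> S" if "A \<subseteq> {..<?n}" for A using f that by blast
  have lin_sum: "F (\<Sum>i\<in>I. r i *\<^sub>R h i) = (\<Sum>i\<in>I. r i *\<^sub>R F (h i))"
    if F: "clinear_on S F" and "finite I" "\<And>i. i \<in> I \<Longrightarrow> h i \<in> S" for F I r and h :: "nat \<Rightarrow> 'a"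
    using that(2,3)
  proof (induction I rule: finite_induct)
    case empty
    have "F (0 *\<^sub>C 0) = 0 *\<^sub>C F 0" using F S0 unfolding clinear_on_def by blast
    then show ?case by (simp add: scaleC_zero_left)
  next
    case (insert i I)
    have "F (r i *\<^sub>R h i + (\<Sum>i\<in>I. r i *\<^sub>R h i)) = F (r i *\<^sub>R h i) + F (\<Sum>i\<in>I. r i *\<^sub>R h i)"
    proof -
      have "r i *\<^sub>R h i \<in> S" "(\<Sum>i\<in>I. r i *\<^sub>R h i) \<in> S"
        using insert.prems by (auto intro!: SR Ssum)
      then show ?thesis using F unfolding clinear_on_def by blast
    qed
    moreover have "F (r i *\<^sub>R h i) = r i *\<^sub>R F (h i)"
      using F insert.prems by (simp add: clinear_on_def scaleR_scaleC)
    ultimately show ?case using insert by simp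
  qed
  have Dlin: "clinear_on S (D i)" if "i < ?n" for i
    using T_clinear_nth[OF that]
    by (simp add: clinear_on_def D_def scaleC_add_right scaleC_diff_right scaleC_scaleC mult.commute)
  have BD: "B k (D i v) = D i (B k v)" if "i < ?n" "k < ?n" "v \<in> S" for i k v
  proof -
    have "B k ((Ts ! i) v + (- xs ! i) *\<^sub>C v) = B k ((Ts ! i) v) + (- xs ! i) *\<^sub>C B k v"
      using Blin[OF that(2)] T_mem that SC by (simp add: clinear_on_def)
    then show ?thesis using comm[OF that(2,1,3)] by (simp add: D_def scaleC_minus_left)
  qed
  have DS: "D i v \<in> S" if "i < ?n" "v \<in> S" for i v
    unfolding D_def using that by (intro Sdiff T_mem SC)
  define g where "g A = (\<Sum>k\<in>{..<?n} - A. e k A *\<^sub>R B k (f (insert k A)))" for A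
  have "g \<in> Pow {..<?n} \<rightarrow> S"
    unfolding g_def by (intro funcsetI Ssum SR BS fS) auto
  moreover have "f A = koszul_diff Ts xs g A" if A: "A \<subseteq> {..<?n}" for A
  proof -
    let ?C = "{..<?n} - A"
    let ?t = "\<lambda>i k. (e i A * e k (A - {i})) *\<^sub>R D i (B k (f (insert k (A - {i}))))"
    have finA: "finite A" using A finite_subset by blast
    have i: "e i A *\<^sub>R D i (g (A - {i})) = D i (B i (f A)) + (\<Sum>k\<in>?C. ?t i k)" if "i \<in> A" for i
    proof -
      have "i < ?n" using that A by blast
      have "D i (g (A - {i})) = (\<Sum>k\<in>{..<?n} - (A - {i}). e k (A - {i}) *\<^sub>R D i (B k (f (insert k (A - {i})))))"
        unfolding g_def using A \<open>i < ?n\<close>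
        by (intro lin_sum Dlin BS fS) auto
      also have "{..<?n} - (A - {i}) = insert i ?C" using that \<open>i < ?n\<close> by auto
      finally show ?thesis
        using that by (simp add: scaleR_add_right scaleR_sum_right e_same e2 insert_absorb)
    qed
    have k: "D k (B k (f A)) = (\<Sum>i\<in>A. ?t i k)" if "k \<in> ?C" for k
    proof -
      have k: "k < ?n" "k \<notin> A" using that by auto
      let ?r = "\<Sum>i\<in>A. e i (insert k A) *\<^sub>R D i (f (insert k A - {i}))"
      have "0 = koszul_diff Ts xs f (insert k A)" using ker A k by simp
      also have "\<dots> = e k A *\<^sub>R D k (f A) + ?r"
        using k finA by (simp add: diff e_same)
      finally have "e k A *\<^sub>R (e k A *\<^sub>R D k (f A) + ?r) = 0" by simp
      then have "D k (f A) = - (e k A *\<^sub>R ?r)"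
        by (simp add: scaleR_add_right e2 eq_neg_iff_add_eq_0)
      also have "\<dots> = (\<Sum>i\<in>A. (- (e k A * e i (insert k A))) *\<^sub>R D i (f (insert k A - {i})))"
        by (simp add: scaleR_sum_right sum_negf)
      also have "\<dots> = (\<Sum>i\<in>A. (e i A * e k (A - {i})) *\<^sub>R D i (f (insert k (A - {i}))))"
        using k finA by (intro sum.cong refl) (auto simp: e_swap insert_Diff_if)
      finally have "B k (D k (f A)) = B k (\<Sum>i\<in>A. (e i A * e k (A - {i})) *\<^sub>R D i (f (insert k (A - {i}))))"
        by simp
      also have "\<dots> = (\<Sum>i\<in>A. (e i A * e k (A - {i})) *\<^sub>R B k (D i (f (insert k (A - {i})))))"
        using A k finA by (intro lin_sum Blin DS fS) auto
      also have "\<dots> = (\<Sum>i\<in>A. ?t i k)"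
        using A k by (intro sum.cong refl) (subst BD, auto intro: fS)
      finally show ?thesis using BD[OF k(1) k(1) fS[OF A]] by simp
    qed
    have "koszul_diff Ts xs g A = (\<Sum>i\<in>A. D i (B i (f A))) + (\<Sum>i\<in>A. \<Sum>k\<in>?C. ?t i k)"
      by (simp add: diff i sum.distrib)
    also have "(\<Sum>i\<in>A. \<Sum>k\<in>?C. ?t i k) = (\<Sum>k\<in>?C. D k (B k (f A)))"
      by (subst sum.swap) (simp add: k)
    also have "(\<Sum>i\<in>A. D i (B i (f A))) + \<dots> = (\<Sum>i<?n. D i (B i (f A)))"
      using sum.subset_diff[OF A, of "\<lambda>i. D i (B i (f A))"] by (simp add: add.commute)
    also have "\<dots> = f A" using unit[OF fS[OF A]] by (simp add: D_def)
    finally show ?thesis by simp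
  qed
  ultimately show "\<exists>g\<in>Pow {..<?n} \<rightarrow> S. \<forall>A\<subseteq>{..<?n}. f A = koszul_diff Ts xs g A"
    by blast
qed

lemma T_zero: "i < length Ts \<Longrightarrow> (Ts ! i) 0 = 0"
proof -
  assume "i < length Ts"
  then have "(Ts ! i) (0 *\<^sub>C 0) = 0 *\<^sub>C (Ts ! i) 0"
    using T_clinear_nth S0 unfolding clinear_on_def by blast
  then show ?thesis by (simp add: scaleC_zero_left)
qed

text \<open>
  An inverse of \<open>T\<^sub>i - x\<^sub>i\<close> commutes with all \<open>T\<^sub>j\<close>, so it gives a Bezout identity with a single term.
\<close>

lemma spectrum_not_bij:
  assumes xs: "xs \<in> taylor_spectrum S Ts" and i: "i < length Ts"
  shows "\<not> bij_betw (\<lambda>v. (Ts ! i) v - xs ! i *\<^sub>C v) S S"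
proof
  define D where "D v = (Ts ! i) v - xs ! i *\<^sub>C v" for v
  assume "bij_betw (\<lambda>v. (Ts ! i) v - xs ! i *\<^sub>C v) S S"
  then have D: "bij_betw D S S" by (simp only: D_def[abs_def])
  define R where "R = inv_into S D"
  have RS: "R v \<in> S" and DR: "D (R v) = v" if "v \<in> S" for v
    using D that unfolding R_def by (auto simp: bij_betw_def inv_into_into f_inv_into_f)
  have RD: "R (D v) = v" if "v \<in> S" for v
    using D that unfolding R_def by (simp add: bij_betw_def)
  have lin: "(Ts ! i) (v + w) = (Ts ! i) v + (Ts ! i) w" "(Ts ! i) (c *\<^sub>C v) = c *\<^sub>C (Ts ! i) v"
    if "v \<in> S" "w \<in> S" for v w c
    using T_clinear_nth[OF i] that by (simp_all add: clinear_on_def)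
  have R_add: "R (v + w) = R v + R w" if "v \<in> S" "w \<in> S" for v w
  proof -
    have "D (R v + R w) = v + w"
      using lin(1)[OF RS RS, OF that] DR[OF that(1)] DR[OF that(2)]
      by (simp add: D_def scaleC_add_right algebra_simps)
    then show ?thesis using RD[OF Sadd[OF RS RS, OF that]] by simp
  qed
  have R_C: "R (c *\<^sub>C v) = c *\<^sub>C R v" if "v \<in> S" for c v
  proof -
    have "D (c *\<^sub>C R v) = c *\<^sub>C D (R v)"
      using lin(2)[OF RS RS, OF that that]
      by (simp add: D_def scaleC_diff_right scaleC_scaleC mult.commute)
    then show ?thesis using RD[OF SC[OF RS], OF that, of c] DR[OF that] by simp
  qed
  have R_T: "R ((Ts ! j) v) = (Ts ! j) (R v)" if j: "j < length Ts" and v: "v \<in> S" for j v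
  proof -
    have "D ((Ts ! j) (R v)) = (Ts ! j) (D (R v))"
    proof -
      have "(Ts ! j) ((Ts ! i) (R v)) = (Ts ! j) (D (R v) + xs ! i *\<^sub>C R v)" by (simp add: D_def)
      also have "\<dots> = (Ts ! j) (D (R v)) + xs ! i *\<^sub>C (Ts ! j) (R v)"
        using T_clinear_nth[OF j] DR[OF v] v RS[OF v] SC[OF RS[OF v]] by (simp add: clinear_on_def)
      finally show ?thesis by (simp add: D_def[of "(Ts ! j) (R v)"] T_commute_nth[OF i j RS[OF v]])
    qed
    then show ?thesis using RD[OF T_mem[OF j RS[OF v]]] DR[OF v] by simp
  qed
  define B where "B l v = (if l = i then R v else 0)" for l v
  have "koszul_exact S Ts xs"
  proof (rule koszul_exact_of_bezout[where B = B])
    fix x assume x: "x \<in> S"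
    have "(Ts ! l) (B l x) - xs ! l *\<^sub>C B l x = (if l = i then x else 0)" if "l < length Ts" for l
      using DR[OF x] T_zero[OF that] by (simp add: B_def D_def)
    then have "(\<Sum>l<length Ts. (Ts ! l) (B l x) - xs ! l *\<^sub>C B l x) = (\<Sum>l<length Ts. if l = i then x else 0)"
      by (intro sum.cong) auto
    also have "\<dots> = x" using i by simp
    finally show "(\<Sum>l<length Ts. (Ts ! l) (B l x) - xs ! l *\<^sub>C B l x) = x" .
  qed (auto simp: B_def RS S0 R_T T_zero clinear_on_def R_add R_C)
  then show False using xs by (simp add: taylor_spectrum_def)
qed

text \<open>
  If \<open>T\<^sub>i = T\<^sub>jT\<^sub>k\<close>, then \<open>(T\<^sub>j - x\<^sub>j)T\<^sub>k + (T\<^sub>k - x\<^sub>k)x\<^sub>j - (T\<^sub>i - x\<^sub>i) = x\<^sub>i - x\<^sub>jx\<^sub>k\<close>, which is a Bezout identity after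
  division by the right-hand side unless that vanishes.
\<close>

lemma spectrum_product:
  assumes xs: "xs \<in> taylor_spectrum S Ts"
    and ijk: "i < length Ts" "j < length Ts" "k < length Ts" "i \<noteq> j" "i \<noteq> k" "j \<noteq> k"
    and prod: "\<And>v. v \<in> S \<Longrightarrow> (Ts ! i) v = (Ts ! j) ((Ts ! k) v)"
  shows "xs ! i = xs ! j * xs ! k"
proof (rule ccontr)
  define c where "c = xs ! i - xs ! j * xs ! k"
  assume "xs ! i \<noteq> xs ! j * xs ! k"
  then have c: "c \<noteq> 0" by (simp add: c_def)
  define B where "B l v = (if l = j then (1 / c) *\<^sub>C (Ts ! k) v else
      if l = k then (xs ! j / c) *\<^sub>C v else if l = i then (- 1 / c) *\<^sub>C v else 0)" for l v
  have lin: "(Ts ! l) (v + w) = (Ts ! l) v + (Ts ! l) w" "(Ts ! l) (d *\<^sub>C v) = d *\<^sub>C (Ts ! l) v"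
    if "l < length Ts" "v \<in> S" "w \<in> S" for l v w d
    using T_clinear_nth[OF that(1)] that(2,3) by (simp_all add: clinear_on_def)
  have "koszul_exact S Ts xs"
  proof (rule koszul_exact_of_bezout[where B = B])
    show "B l x \<in> S" if "l < length Ts" "x \<in> S" for l x
      using that ijk by (simp add: B_def SC T_mem S0)
    show "clinear_on S (B l)" if "l < length Ts" for l
      using ijk T_clinear_nth[OF ijk(3)]
      by (simp add: B_def clinear_on_def scaleC_add_right scaleC_scaleC mult.commute)
    show "B l ((Ts ! m) x) = (Ts ! m) (B l x)" if "l < length Ts" "m < length Ts" "x \<in> S" for l m x
      using ijk that T_mem[OF ijk(3) that(3)] T_commute_nth[OF ijk(3) that(2,3)]
      by (simp add: B_def lin(2)[OF that(2)] T_zero)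
    fix x assume x: "x \<in> S"
    let ?h = "\<lambda>l. (Ts ! l) (B l x) - xs ! l *\<^sub>C B l x"
    have "(\<Sum>l<length Ts. ?h l) = (\<Sum>l\<in>{i, j, k}. ?h l)"
      using ijk by (intro sum.mono_neutral_right) (auto simp: B_def T_zero)
    also have "\<dots> = ?h i + ?h j + ?h k" using ijk by (simp add: add.assoc)
    also have "?h i = (- 1 / c) *\<^sub>C (Ts ! j) ((Ts ! k) x) - (xs ! i * (- 1 / c)) *\<^sub>C x"
      using ijk x by (simp add: B_def lin(2)[OF ijk(1) x x] prod scaleC_scaleC)
    also have "?h j = (1 / c) *\<^sub>C (Ts ! j) ((Ts ! k) x) - (xs ! j * (1 / c)) *\<^sub>C (Ts ! k) x"
      using ijk T_mem[OF ijk(3) x] by (simp add: B_def lin(2)[OF ijk(2)] scaleC_scaleC)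
    also have "?h k = (xs ! j / c) *\<^sub>C (Ts ! k) x - (xs ! k * (xs ! j / c)) *\<^sub>C x"
      using ijk by (simp add: B_def lin(2)[OF ijk(3) x x] scaleC_scaleC)
    also have "(- 1 / c) *\<^sub>C (Ts ! j) ((Ts ! k) x) - (xs ! i * (- 1 / c)) *\<^sub>C x +
        ((1 / c) *\<^sub>C (Ts ! j) ((Ts ! k) x) - (xs ! j * (1 / c)) *\<^sub>C (Ts ! k) x) +
        ((xs ! j / c) *\<^sub>C (Ts ! k) x - (xs ! k * (xs ! j / c)) *\<^sub>C x)
      = (- 1 / c + 1 / c) *\<^sub>C (Ts ! j) ((Ts ! k) x) + (xs ! j / c - xs ! j * (1 / c)) *\<^sub>C (Ts ! k) x
        + (- (xs ! i * (- 1 / c)) - xs ! k * (xs ! j / c)) *\<^sub>C x"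
      by (simp only: scaleC_add_left scaleC_diff_left scaleC_minus_left) (simp add: algebra_simps)
    also have "\<dots> = x"
    proof -
      have "- (xs ! i * (- 1 / c)) - xs ! k * (xs ! j / c) = 1"
        using c by (simp add: field_simps) (simp add: c_def algebra_simps)
      then show ?thesis by (simp add: scaleC_zero_left scaleC_one)
    qed
    finally show "(\<Sum>l<length Ts. ?h l) = x" .
  qed
  then show False using xs by (simp add: taylor_spectrum_def)
qed

end

section \<open>The distinguished torus\<close>

definition diag3 :: "(3 \<Rightarrow> complex) \<Rightarrow> complex ^ 3 ^ 3" where
  "diag3 d = (\<chi> i j. if i = j then d i else 0)"

text \<open>
  If \<open>X\<close> is diagonal and \<open>1 - AX\<close> is singular, then \<open>d\<^sub>iX\<^sub>i\<^sub>i = 1\<close> for some \<open>i\<close>, so \<open>\<parallel>X\<parallel> \<ge> \<bar>X\<^sub>i\<^sub>i\<bar> \<ge> 1\<close>.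
\<close>

lemma mu_diagonal_le_1:
  assumes d: "\<And>i. norm (d i) \<le> 1"
  shows "mu E_33111 (diag3 d) \<le> 1"
proof -
  let ?N = "{onorm (\<lambda>v. X *v v) | X. X \<in> E_33111 \<and> det (mat 1 - diag3 d ** X) = 0}"
  have "1 \<le> onorm (\<lambda>v. X *v v)" if X: "X \<in> E_33111" "det (mat 1 - diag3 d ** X) = 0" for X
  proof -
    have off: "X $ i $ j = 0" if "i \<noteq> j" for i j using X(1) that by (simp add: E_33111_def)
    have prod: "(diag3 d ** X) $ i $ j = d i * X $ i $ j" for i j
      by (simp add: diag3_def matrix_matrix_mult_def if_distrib[of "\<lambda>x. x * _"] cong: if_cong)
    have "det (mat 1 - diag3 d ** X) = (\<Prod>i\<in>UNIV. 1 - d i * X $ i $ i)"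
      by (subst det_diagonal) (simp_all add: prod off mat_def)
    with X(2) obtain i where i: "d i * X $ i $ i = 1" by auto
    have "1 = norm (d i) * norm (X $ i $ i)" using i by (metis norm_mult norm_one)
    also have "\<dots> \<le> 1 * norm (X $ i $ i)" by (intro mult_right_mono d) simp
    also have "\<dots> = norm ((X *v axis i 1) $ i)"
      by (simp add: matrix_vector_mult_def axis_def if_distrib[of "\<lambda>x. _ * x"] cong: if_cong)
    also have "\<dots> \<le> norm (X *v axis i 1)" by (rule Finite_Cartesian_Product.norm_nth_le)
    also have "\<dots> \<le> onorm (\<lambda>v. X *v v) * norm (axis i (1::complex))"
      by (rule onorm) simp
    finally show ?thesis by (simp add: norm_axis_1)
  qed
  then have "1 \<le> Inf ?N" if "\<exists>X\<in>E_33111. det (mat 1 - diag3 d ** X) = 0"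
    using that by (intro cInf_greatest) auto
  then show ?thesis
    by (cases "\<exists>X\<in>E_33111. det (mat 1 - diag3 d ** X) = 0") (simp_all add: mu_def)
qed

text \<open>
  The matrix is \<open>diag(u, v, uv)\<close>; the three conjugation relations hold because \<open>\<bar>u\<bar> = \<bar>v\<bar> = 1\<close>.
\<close>

lemma torus_in_K_E:
  assumes "norm u = 1" "norm v = 1"
  shows "[u, v, u * v, u * v, u * (u * v), (u * v) * v, u * ((u * v) * v)] \<in> K_E"
proof -
  define d :: "3 \<Rightarrow> complex" where "d i = (if i = 1 then u else if i = 2 then v else u * v)" for i
  have "mu E_33111 (diag3 d) \<le> 1"
    by (rule mu_diagonal_le_1) (simp add: d_def assms norm_mult)
  moreover have "[u, v, u * v, u * v, u * (u * v), (u * v) * v, u * ((u * v) * v)]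
    = [diag3 d$1$1, diag3 d$2$2, diag3 d$1$1 * diag3 d$2$2 - diag3 d$1$2 * diag3 d$2$1,
       diag3 d$3$3, diag3 d$1$1 * diag3 d$3$3 - diag3 d$1$3 * diag3 d$3$1,
       diag3 d$2$2 * diag3 d$3$3 - diag3 d$2$3 * diag3 d$3$2, det (diag3 d)]"
    by (simp add: diag3_def d_def det_3)
  ultimately have "[u, v, u * v, u * v, u * (u * v), (u * v) * v, u * ((u * v) * v)] \<in> Gamma_E"
    unfolding Gamma_E_def by blast
  moreover have "cnj u * u = 1" "cnj v * v = 1"
    using assms by (simp_all add: complex_norm_square[symmetric] mult.commute[of "cnj _"])
  then have "u = cnj ((u * v) * v) * (u * ((u * v) * v))" "u * v = cnj (u * v) * (u * ((u * v) * v))"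
    "u * (u * v) = cnj v * (u * ((u * v) * v))"
    by (simp_all, algebra+)
  moreover have "norm (u * ((u * v) * v)) = 1" using assms by (simp add: norm_mult)
  ultimately show ?thesis unfolding K_E_def by blast
qed

section \<open>The seven monomials\<close>

definition monomials :: "('a \<Rightarrow> 'a) \<Rightarrow> ('a \<Rightarrow> 'a) \<Rightarrow> ('a \<Rightarrow> 'a) list" where
  "monomials a b =
    [a, b, a \<circ> b, a \<circ> b, (a ^^ 2) \<circ> b, a \<circ> (b ^^ 2), (a ^^ 2) \<circ> (b ^^ 2)]"

lemma length_monomials [simp]: "length (monomials a b) = 7"
  by (simp add: monomials_def)

lemma funpow_2_comp: "f ^^ 2 = f \<circ> f"
  by (simp add: numeral_2_eq_2)

text \<open>
  A property of both generators that passes to compositions holds for every monomial, and likewise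
  for a relation between two pairs of generators.  This transports dilation, extension, unitarity
  and commutation from pairs of operators to the seven-tuples.
\<close>

lemma monomials_all:
  assumes "P a" "P b" "\<And>f g. P f \<Longrightarrow> P g \<Longrightarrow> P (f \<circ> g)" "N \<in> set (monomials a b)"
  shows "P N"
  using assms(4) by (auto simp: monomials_def funpow_2_comp intro!: assms(1-3))

lemma monomials_all2:
  assumes "P a a'" "P b b'" "\<And>f g f' g'. P f f' \<Longrightarrow> P g g' \<Longrightarrow> P (f \<circ> g) (f' \<circ> g')" "i < 7"
  shows "P (monomials a b ! i) (monomials a' b' ! i)"
proof -
  have "list_all2 P (monomials a b) (monomials a' b')"
    by (simp add: monomials_def funpow_2_comp assms(1-3))
  then show ?thesis using assms(4) by (simp add: list_all2_nthD)
qed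

lemma monomials_commuting:
  assumes S: "a ` S \<subseteq> S" "b ` S \<subseteq> S" and ab: "commuting_on S a b"
    and N: "N \<in> set (monomials a b)" "N' \<in> set (monomials a b)"
  shows "commuting_on S N N'"
proof -
  have comm: "commuting_on S c N" if "c ` S \<subseteq> S" "commuting_on S c a" "commuting_on S c b"
    "N \<in> set (monomials a b)" for c N
  proof -
    have "N ` S \<subseteq> S \<and> commuting_on S c N"
      by (rule monomials_all[OF _ _ _ that(4)])
        (use S that in \<open>auto simp: commuting_on_def image_subset_iff\<close>)
    then show ?thesis ..
  qed
  have sym: "commuting_on S f g \<Longrightarrow> commuting_on S g f" for f g by (simp add: commuting_on_def)
  have refl: "commuting_on S f f" for f by (simp add: commuting_on_def)
  have "N ` S \<subseteq> S"
    by (rule monomials_all[OF _ _ _ N(1)]) (use S in \<open>auto simp: image_subset_iff\<close>)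
  then show ?thesis
    by (rule comm[OF _ sym[OF comm[OF S(1) refl ab N(1)]] sym[OF comm[OF S(2) sym[OF ab] refl N(1)]] N(2)])
qed

text \<open>
  The coordinates of a spectral point are unimodular since every monomial is unitary, and they satisfy
  \<open>x\<^sub>2 = x\<^sub>0x\<^sub>1\<close>, \<open>x\<^sub>3 = x\<^sub>0x\<^sub>1\<close>, \<open>x\<^sub>4 = x\<^sub>0x\<^sub>2\<close>, \<open>x\<^sub>5 = x\<^sub>2x\<^sub>1\<close>, \<open>x\<^sub>6 = x\<^sub>0x\<^sub>5\<close> (counting from \<open>0\<close>), so the point is
  determined by \<open>x\<^sub>0\<close> and \<open>x\<^sub>1\<close> and lies on the torus inside \<open>K\<close>.
\<close>

lemma monomials_unitary:
  assumes L: "closed_csubspace L" and U1: "unitary_on L U1 W1" and U2: "unitary_on L U2 W2"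
    and comm: "commuting_on L U1 U2"
  shows "Gamma_unitary L (monomials U1 U2)"
proof -
  let ?Us = "monomials U1 U2"
  have uni: "\<exists>W. unitary_on L N W" if "N \<in> set ?Us" for N
    by (rule monomials_all[OF _ _ _ that]) (use U1 U2 unitary_on_comp in blast)+
  have im: "U1 ` L \<subseteq> L" "U2 ` L \<subseteq> L" using U1 U2 by (simp_all add: unitary_on_def)
  note commuting = monomials_commuting[OF im comm]
  interpret commuting_tuple L ?Us
    by unfold_locales (use L uni commuting in \<open>auto simp: unitary_on_def\<close>)
  have "xs \<in> K_E" if xs: "xs \<in> taylor_spectrum L ?Us" for xs
  proof -
    have "norm (xs ! i) = 1" if i: "i < 7" for i
    proof (rule ccontr)
      assume "norm (xs ! i) \<noteq> 1"
      moreover obtain W where "unitary_on L (?Us ! i) W" using uni[of "?Us ! i"] i by auto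
      ultimately have "bij_betw (\<lambda>v. (?Us ! i) v - xs ! i *\<^sub>C v) L L"
        using unitary_on_minus_scalar_bij L by blast
      then show False using spectrum_not_bij[OF xs] i by simp
    qed
    from this[of 0] this[of 1] have norm: "norm (xs ! 0) = 1" "norm (xs ! 1) = 1" by simp_all
    have eqs: "xs ! 2 = xs ! 0 * xs ! 1" "xs ! 3 = xs ! 0 * xs ! 1" "xs ! 4 = xs ! 0 * xs ! 2"
      "xs ! 5 = xs ! 2 * xs ! 1" "xs ! 6 = xs ! 0 * xs ! 5"
      by (rule spectrum_product[OF xs]; simp add: monomials_def funpow_2_comp)+
    have len: "length xs = 7" using xs by (simp add: taylor_spectrum_def)
    have "xs = [xs ! 0, xs ! 1, xs ! 2, xs ! 3, xs ! 4, xs ! 5, xs ! 6]"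
      by (rule nth_equalityI) (use len in \<open>auto simp: less_Suc_eq numeral_eq_Suc\<close>)
    then show ?thesis using torus_in_K_E[OF norm] unfolding eqs by simp
  qed
  then show ?thesis
    using uni unitary_on_normal[OF _ L] commuting by (auto simp: Gamma_unitary_def)
qed

lemma closed_csubspace_UNIV: "closed_csubspace UNIV"
  by (simp add: closed_csubspace_def)

lemma monomials_isometry:
  fixes V1 V2 :: "'a::chilbert_space \<Rightarrow> 'a"
  assumes V: "cisometry V1" "cisometry V2" and comm: "\<And>x. V1 (V2 x) = V2 (V1 x)"
  shows "Gamma_isometry UNIV (monomials V1 V2)"
proof -
  obtain L :: "'a l2seq set" and U1 U2 W1 W2 where L: "closed_csubspace L"
    and U: "unitary_on L U1 W1" "unitary_on L U2 W2" and U_comm: "\<forall>x\<in>L. U1 (U2 x) = U2 (U1 x)"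
    and ext: "\<forall>k. l2_cons k 0 \<in> L \<and> U1 (l2_cons k 0) = l2_cons (V1 k) 0 \<and>
      U2 (l2_cons k 0) = l2_cons (V2 k) 0"
    using commuting_isometries_unitary_extension[OF V comm] by blast
  have "Gamma_unitary L (monomials U1 U2)"
    using monomials_unitary[OF L U] U_comm by (simp add: commuting_on_def)
  moreover have "isometric_embedding UNIV L (\<lambda>k. l2_cons k 0)"
    using cisometry_cons_zero ext by (auto simp: isometric_embedding_def cisometry_def)
  moreover have "\<forall>x. (monomials U1 U2 ! i) (l2_cons x 0) = l2_cons ((monomials V1 V2 ! i) x) 0"
    if "i < 7" for i
    by (rule monomials_all2[OF _ _ _ that]) (simp_all add: ext)
  ultimately show ?thesis unfolding Gamma_isometry_def using L by auto
qed

text \<open>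
  A dilation whose first coordinate intertwines \<open>V\<close> with \<open>T\<close> is one whose adjoint maps \<open>(h, 0)\<close> to
  \<open>(T\<^sup>*h, 0)\<close>: both say that \<open>\<langle>Vf, (h, 0)\<rangle> = \<langle>f\<^sub>0, T\<^sup>*h\<rangle>\<close>.
\<close>

lemma adj_on_l2_dilation:
  fixes T :: "'a::chilbert_space \<Rightarrow> 'a"
  assumes T: "contraction UNIV T" and V: "clinear_on UNIV V" and hd: "\<And>f. l2_hd (V f) = T (l2_hd f)"
  shows "adj_on UNIV V (l2_cons h 0) = l2_cons (adj_on UNIV T h) 0"
proof -
  obtain T' where T': "\<And>x y. inner (T x) y = inner x (T' y)" using contraction_adjoint[OF T] by blast
  have "clinear_on UNIV T" using T by (simp add: contraction_def)
  then have "adj_on UNIV T h = T' h" by (rule adj_on_eqI[OF closed_csubspace_UNIV]) (simp_all add: T')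
  moreover have "adj_on UNIV V (l2_cons h 0) = l2_cons (T' h) 0"
    by (rule adj_on_eqI[OF closed_csubspace_UNIV V]) (simp_all add: inner_cons_zero hd T')
  ultimately show ?thesis by simp
qed

theorem theorem2p8:
  fixes T1 T2 :: "'a::chilbert_space \<Rightarrow> 'a"
  assumes "contraction UNIV T1" and "contraction UNIV T2"
    and "commuting_on UNIV T1 T2"
  shows "has_Gamma_isometric_dilation UNIV
    [T1,
     T2,
     T1 \<circ> T2,
     T1 \<circ> T2,
     (T1 ^^ 2) \<circ> T2,
     T1 \<circ> (T2 ^^ 2),
     (T1 ^^ 2) \<circ> (T2 ^^ 2)]"
proof -
  obtain V1 V2 :: "'a l2seq \<Rightarrow> 'a l2seq" where V: "cisometry V1" "cisometry V2"
    and V_comm: "\<And>f. V1 (V2 f) = V2 (V1 f)"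
    and hd: "\<And>f. l2_hd (V1 f) = T1 (l2_hd f)" "\<And>f. l2_hd (V2 f) = T2 (l2_hd f)"
    using ando_isometric_dilation[OF assms(1,2)] assms(3) by (auto simp: commuting_on_def)
  have dil: "contraction UNIV (monomials T1 T2 ! i) \<and> clinear_on UNIV (monomials V1 V2 ! i) \<and>
      (\<forall>f. l2_hd ((monomials V1 V2 ! i) f) = (monomials T1 T2 ! i) (l2_hd f))" if "i < 7" for i
  proof (rule monomials_all2[OF _ _ _ that])
    fix f g :: "'a \<Rightarrow> 'a" and f' g' :: "'a l2seq \<Rightarrow> 'a l2seq"
    assume "contraction UNIV f \<and> clinear_on UNIV f' \<and> (\<forall>x. l2_hd (f' x) = f (l2_hd x))"
      "contraction UNIV g \<and> clinear_on UNIV g' \<and> (\<forall>x. l2_hd (g' x) = g (l2_hd x))"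
    then show "contraction UNIV (f \<circ> g) \<and> clinear_on UNIV (f' \<circ> g') \<and>
        (\<forall>x. l2_hd ((f' \<circ> g') x) = (f \<circ> g) (l2_hd x))"
      by (auto simp: contraction_def clinear_on_def intro: order_trans)
  qed (use assms V hd in \<open>simp_all add: cisometry_def\<close>)
  have "isometric_embedding UNIV UNIV (\<lambda>h::'a. l2_cons h 0)"
    using cisometry_cons_zero by (auto simp: isometric_embedding_def cisometry_def)
  moreover have "\<forall>i<7. \<forall>h. adj_on UNIV (monomials V1 V2 ! i) (l2_cons h 0)
      = l2_cons (adj_on UNIV (monomials T1 T2 ! i) h) 0"
    using dil adj_on_l2_dilation by blast
  ultimately have "has_Gamma_isometric_dilation UNIV (monomials T1 T2)"
    unfolding has_Gamma_isometric_dilation_def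
    using monomials_isometry[OF V V_comm] closed_csubspace_UNIV by blast
  then show ?thesis by (simp only: monomials_def)
qed

end
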